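(* Let $p\ge q\ge 1$, $X=E=\mathbf{R}^{p\times q}$ with the low-rank sparsity structure described in the context (with $B$ the identity), let $A:\mathbf{R}^{p\times q}\to\mathbf{R}^m$ be linear, $\phi(\cdot)$ a norm on $\mathbf{R}^m$, $s$ a nonnegative integer, $\gamma\ge0$, $\beta\in[0,\infty]$. The norm $$\|z\|_{\mathcal{P}_s}:=\Sigma_s(z)+\Sigma_{2s}(z)$$ satisfies $$\forall z\in\mathbf{R}^{p\times q},\ P\in\mathcal{P}_s:\quad \|P(z)\|+\|z\|-\|\overline{P}(z)\|\le\|z\|_{\mathcal{P}_s},$$ so that the condition $$(\ast)\qquad\forall z\in\mathbf{R}^{p\times q}:\quad\Sigma_s(z)+\Sigma_{2s}(z)\le\beta\phi(Az)+\gamma\|z\|$$ is sufficient for the validity of $\mathbf{C}^+_s(\gamma,\beta;\phi)$, and thus for the validity of $\mathbf{C}_s(\gamma,\beta;\phi)$. As a result, condition $(\ast)$ with $\gamma<1$ is sufficient for $s$-goodness of $A$ and, when $\beta<\infty$, for the following error bounds: (i) (regular recovery) whenever $\epsilon,\delta_x,\delta_\phi,\delta\ge0$, $x,\widehat{x}\in X$, $y=Ax+\xi$ with $\phi(\xi)\le\epsilon$, there is $P\in\mathcal{P}_s$ with $\|x-P(x)\|\le\delta_x$, $\phi(A\widehat{x}-y)\le\epsilon+\delta_\phi$, and $\|\widehat{x}\|\le\min_{u\in X}\{\|u\|:\phi(Au-y)\le\epsilon\}+\delta$, one has $$\|\widehat{x}-x\|\le\frac{\beta[2\epsilon+\delta_\phi]+\delta+2\delta_x}{1-\gamma};$$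 (ii) (penalized recovery) whenever $\lambda>0$, $\lambda\ge\beta$, $\delta_x,\delta\ge0$, $x,\widehat{x}\in X$, $y\in\mathbf{R}^m$, $\xi=y-Ax$, there is $P\in\mathcal{P}_s$ with $\|x-P(x)\|\le\delta_x$, and $\lambda\phi(A\widehat{x}-y)+\|\widehat{x}\|\le\min_{z\in X}\{\lambda\phi(Az-y)+\|z\|\}+\delta$, one has $$\|\widehat{x}-x\|\le\frac{2\delta_x+\delta+2\lambda\phi(\xi)}{1-\gamma}.$$
   Context: Low-rank setting. $X=E=\mathbf{R}^{p\times q}$, $p\ge q$, with the Frobenius inner product, $B$ the identity. $\sigma_1(z)\ge\dots\ge\sigma_q(z)$ are the singular values of $z\in\mathbf{R}^{p\times q}$; $\|z\|=\sum_{j=1}^q\sigma_j(z)$ is the nuclear norm. $\Sigma_k(z)=\sum_{i=1}^{\min(k,q)}\sigma_i(z)$ for integers $k\ge0$ (so $\Sigma_0=0$). "Norm" for $\|\cdot\|_{\mathcal{P}_s}$ is understood as (semi)norm when $s=0$. The family $\mathcal{P}$ consists of the maps $P(x)=P_{\rm left}\,x\,P_{\rm right}$, indexed by pairs of orthoprojectors $P_{\rm left}\in\mathbf{R}^{p\times p}$, $P_{\rm right}\in\mathbf{R}^{q\times q}$; with such $P$ are associated $\overline{P}(x)=(I_p-P_{\rm left})x(I_q-P_{\rm right})$ and the weight $\nu(P)=\max[\mathrm{Rank}(P_{\rm left}),\mathrm{Rank}(P_{\rm right})]$. $\mathcal{P}_s=\{P\in\mathcal{P}:\nu(P)\le s\}$.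 A matrix $x$ is $s$-sparse if $P(x)=x$ for some $P\in\mathcal{P}_s$ (equivalently, $\mathrm{Rank}(x)\le s$). $A$ is $s$-good if for every $s$-sparse $x$, every $\widehat{x}\in\mathrm{Argmin}_{u\in X}\{\|u\|:Au=Ax\}$ equals $x$. Condition $\mathbf{C}_s(\gamma,\beta;\phi)$: for all $z\in X$, $P\in\mathcal{P}_s$: $\|P(z)\|+\|z\|-\|\overline{P}(z)\|\le\beta\phi(Az)+\gamma\|z\|$. Condition $\mathbf{C}^+_s(\gamma,\beta;\phi)$: there exists a (semi)norm $\|\cdot\|_{\mathcal{P}_s}$ on $E$ such that (a) for all $z\in X$, $P\in\mathcal{P}_s$: $\|P(z)\|+\|z\|-\|\overline{P}(z)\|\le\|z\|_{\mathcal{P}_s}$; and (b) for all $z\in X$: $\|z\|_{\mathcal{P}_s}\le\beta\phi(Az)+\gamma\|z\|$. Convention: $(+\infty)\cdot0=0$ and $(+\infty)\cdot a=+\infty$ for $a>0$. *)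

theory Defs
  imports "HOL-Analysis.Analysis" "HOL-Computational_Algebra.Polynomial"
begin

text \<open>
  A \<open>p \<times> q\<close> matrix has type \<^typ>\<open>real^'q^'p\<close> (rows are indexed by \<open>'p\<close>, columns by \<open>'q\<close>),
  so \<open>p = CARD('p)\<close> and \<open>q = CARD('q)\<close>.
\<close>

definition is_seminorm :: "('a::real_vector \<Rightarrow> real) \<Rightarrow> bool" where
  "is_seminorm N \<longleftrightarrow>
     (\<forall>x. 0 \<le> N x) \<and> (\<forall>c x. N (c *\<^sub>R x) = \<bar>c\<bar> * N x) \<and> (\<forall>x y. N (x + y) \<le> N x + N y)"

definition is_norm :: "('a::real_vector \<Rightarrow> real) \<Rightarrow> bool" where
  "is_norm N \<longleftrightarrow> is_seminorm N \<and> (\<forall>x. N x = 0 \<longrightarrow> x = 0)"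


subsection \<open>Singular values\<close>

definition charpoly :: "real^'n^'n \<Rightarrow> real poly" where
  "charpoly M = det (mat [:0, 1:] - (\<chi> i j. [:M $ i $ j:]))"

text \<open>
  The singular values are the square roots of the eigenvalues of \<open>z\<^sup>T z\<close>, counted with (algebraic)
  multiplicity and listed in decreasing order. As \<open>z\<^sup>T z\<close> is symmetric positive semidefinite, the
  list has length \<open>q\<close> and its entries are nonnegative.
\<close>
definition singular_values :: "real^'q^'p \<Rightarrow> real list" where
  "singular_values z =
     rev (sorted_list_of_multiset (image_mset sqrt (proots (charpoly (transpose z ** z)))))"

text \<open>Indices start at 1: \<open>sigma j z\<close> is meaningful for \<open>1 \<le> j \<le> q\<close>.\<close>
definition sigma :: "nat \<Rightarrow> real^'q^'p \<Rightarrow> real" where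
  "sigma j z = singular_values z ! (j - 1)"

definition nuclear_norm :: "real^'q^'p \<Rightarrow> real" where
  "nuclear_norm z = (\<Sum>j = 1..CARD('q). sigma j z)"

definition Sigma_sum :: "nat \<Rightarrow> real^'q^'p \<Rightarrow> real" where
  "Sigma_sum k z = (\<Sum>i = 1..min k CARD('q). sigma i z)"


subsection \<open>The low-rank sparsity structure\<close>

definition orthoprojector :: "real^'n^'n \<Rightarrow> bool" where
  "orthoprojector M \<longleftrightarrow> M ** M = M \<and> transpose M = M"

text \<open>A member of the family is given by its pair \<open>(P_left, P_right)\<close>.\<close>
type_synonym ('p, 'q) proj_pair = "(real^'p^'p) \<times> (real^'q^'q)"

definition proj_family :: "('p::finite, 'q::finite) proj_pair set" where
  "proj_family = {P. orthoprojector (fst P) \<and> orthoprojector (snd P)}"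

definition proj_app :: "('p::finite, 'q::finite) proj_pair \<Rightarrow> real^'q^'p \<Rightarrow> real^'q^'p" where
  "proj_app P x = fst P ** x ** snd P"

definition proj_bar :: "('p::finite, 'q::finite) proj_pair \<Rightarrow> real^'q^'p \<Rightarrow> real^'q^'p" where
  "proj_bar P x = (mat 1 - fst P) ** x ** (mat 1 - snd P)"

definition weight :: "('p::finite, 'q::finite) proj_pair \<Rightarrow> nat" where
  "weight P = max (rank (fst P)) (rank (snd P))"

definition proj_family_le :: "nat \<Rightarrow> ('p::finite, 'q::finite) proj_pair set" where
  "proj_family_le s = {P \<in> proj_family. weight P \<le> s}"

definition sparse :: "nat \<Rightarrow> real^'q^'p \<Rightarrow> bool" where
  "sparse s x \<longleftrightarrow> (\<exists>P \<in> proj_family_le s. proj_app P x = x)"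

definition s_good :: "nat \<Rightarrow> (real^'q^'p \<Rightarrow> real^'m) \<Rightarrow> bool" where
  "s_good s A \<longleftrightarrow>
     (\<forall>x xh. sparse s x \<and> is_arg_min nuclear_norm (\<lambda>u. A u = A x) xh \<longrightarrow> xh = x)"


subsection \<open>The conditions\<close>

text \<open>
  The parameter \<open>\<beta>\<close> ranges over \<open>[0, \<infinity>]\<close>; multiplication of extended reals satisfies
  \<open>\<infinity> * 0 = 0\<close> and \<open>\<infinity> * a = \<infinity>\<close> for \<open>a > 0\<close>.
\<close>

definition cond_C ::
  "nat \<Rightarrow> real \<Rightarrow> ereal \<Rightarrow> (real^'m \<Rightarrow> real) \<Rightarrow> (real^'q^'p \<Rightarrow> real^'m) \<Rightarrow> bool" where
  "cond_C s \<gamma> \<beta> \<phi> A \<longleftrightarrow>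
     (\<forall>z. \<forall>P \<in> proj_family_le s.
        ereal (nuclear_norm (proj_app P z) + nuclear_norm z - nuclear_norm (proj_bar P z))
          \<le> \<beta> * ereal (\<phi> (A z)) + ereal (\<gamma> * nuclear_norm z))"

text \<open>``(Semi)norm'' is read as: a norm if \<open>s \<ge> 1\<close>, a seminorm if \<open>s = 0\<close>.\<close>
definition is_norm_level :: "nat \<Rightarrow> ('a::real_vector \<Rightarrow> real) \<Rightarrow> bool" where
  "is_norm_level s N \<longleftrightarrow> (if s = 0 then is_seminorm N else is_norm N)"

definition dominates_proj :: "nat \<Rightarrow> (real^'q^'p \<Rightarrow> real) \<Rightarrow> bool" where
  "dominates_proj s N \<longleftrightarrow>
     (\<forall>z. \<forall>P \<in> proj_family_le s.
        nuclear_norm (proj_app P z) + nuclear_norm z - nuclear_norm (proj_bar P z) \<le> N z)"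

definition cond_Cplus ::
  "nat \<Rightarrow> real \<Rightarrow> ereal \<Rightarrow> (real^'m \<Rightarrow> real) \<Rightarrow> (real^'q^'p \<Rightarrow> real^'m) \<Rightarrow> bool" where
  "cond_Cplus s \<gamma> \<beta> \<phi> A \<longleftrightarrow>
     (\<exists>N. is_norm_level s N \<and> dominates_proj s N \<and>
        (\<forall>z. ereal (N z) \<le> \<beta> * ereal (\<phi> (A z)) + ereal (\<gamma> * nuclear_norm z)))"

end

theory Submission
  imports Defs
begin

text \<open>
  The sum \<open>\<Sigma>\<^sub>k(z)\<close> is the maximum of \<open>\<Sum>i. a i \<bullet> (z *v b i)\<close> over pairs of contractive families
  \<open>a\<close>, \<open>b\<close> with squared lengths summing to at most \<open>k\<close>. The norm axioms follow at once, and since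
  orthoprojectors act on such families, so do \<open>\<parallel>P(z)\<parallel> \<le> \<Sigma>\<^sub>s(z)\<close> (the trace of a projector is its
  rank) and the pinching inequality \<open>\<parallel>P(z)\<parallel> + \<parallel>Pbar(z)\<parallel> \<le> \<parallel>z\<parallel>\<close>.
  The remaining inequality \<open>\<parallel>z\<parallel> - \<parallel>Pbar(z)\<parallel> \<le> \<Sigma>\<^sub>2\<^sub>s(z)\<close> comes from testing the nuclear norm of
  \<open>Pbar(z)\<close> on a subspace of codimension at most \<open>2s\<close> on which it defines the same form as \<open>z\<close>.
  The recovery bounds combine pinching, applied to \<open>xh\<close>, with the condition at \<open>xh - x\<close>.
\<close>

subsection \<open>Spectral theorem and singular value decomposition\<close>

text \<open>Near \<open>0\<close> a nonzero linear term outgrows any quadratic one. This extracts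
  the first-order condition at a maximizer.\<close>

lemma linear_dominated_by_quadratic_zero:
  fixes a b :: real
  assumes "\<And>t. a * t \<le> b * t\<^sup>2"
  shows "a = 0"
proof (rule ccontr)
  assume "a \<noteq> 0"
  \<comment> \<open>\<open>t\<close> has the sign of \<open>a\<close> and makes the quadratic bound
    at most \<open>a * t / 2\<close>, half of the positive number \<open>a * t\<close>.\<close>
  define t where "t = a / (2 * (\<bar>b\<bar> + 1))"
  have "a * t \<le> b * t\<^sup>2" by (rule assms)
  also have "\<dots> \<le> (\<bar>b\<bar> + 1) * t\<^sup>2" by (intro mult_right_mono) auto
  also have "\<dots> = ((\<bar>b\<bar> + 1) * t) * t" by (simp add: power2_eq_square)
  also have "(\<bar>b\<bar> + 1) * t = a / 2" unfolding t_def by (simp add: add_pos_nonneg divide_simps)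
  finally have "a * t \<le> 0" by simp
  moreover have "a * t = a\<^sup>2 / (2 * (\<bar>b\<bar> + 1))" by (simp add: t_def power2_eq_square)
  moreover have "\<dots> > 0" using \<open>a \<noteq> 0\<close> by (intro divide_pos_pos) auto
  ultimately show False by linarith
qed

text \<open>A maximizer \<open>x\<close> of the quadratic form on the compact unit sphere of
  \<open>S\<close> is an eigenvector: moving along the residual \<open>y = f x - l x\<close>, which
  lies in \<open>S\<close> by invariance, would otherwise gain
  \<open>2 * t * (y \<bullet> y)\<close> to first order.\<close>

lemma selfadjoint_eigenvector:
  fixes f :: "'a::euclidean_space \<Rightarrow> 'a"
  assumes lin: "linear f" and sa: "\<And>x y. f x \<bullet> y = x \<bullet> f y"
    and S: "subspace S" "f ` S \<subseteq> S" "S \<noteq> {0}"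
  obtains x l where "x \<in> S" "norm x = 1" "f x = l *\<^sub>R x"
proof -
  interpret linear f by fact
  have "compact (S \<inter> sphere 0 1)"
    using S(1) by (intro closed_Int_compact closed_subspace) auto
  moreover obtain y where y: "y \<in> S" "y \<noteq> 0" using S subspace_0 by blast
  then have "y /\<^sub>R norm y \<in> S \<inter> sphere 0 1" using S(1) by (simp add: subspace_scale)
  moreover have "continuous_on (S \<inter> sphere 0 1) (\<lambda>x. x \<bullet> f x)"
    by (intro continuous_intros linear_continuous_on) (simp add: lin linear_linear)
  ultimately obtain x where x: "x \<in> S" "norm x = 1"
    and mx: "\<And>z. z \<in> S \<Longrightarrow> norm z = 1 \<Longrightarrow> z \<bullet> f z \<le> x \<bullet> f x"
    using continuous_attains_sup[of "S \<inter> sphere 0 1" "\<lambda>x. x \<bullet> f x"] that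
    by (metis (no_types, lifting) IntD1 IntD2 IntI empty_iff mem_sphere_0)
  define l where "l = x \<bullet> f x"
  have le: "z \<bullet> f z \<le> l * (z \<bullet> z)" if "z \<in> S" for z
  proof (cases "z = 0")
    case False
    have "(z /\<^sub>R norm z) \<bullet> f (z /\<^sub>R norm z) \<le> l"
      unfolding l_def using that False S(1) by (intro mx) (simp_all add: subspace_scale)
    then have "z \<bullet> f z / (norm z)\<^sup>2 \<le> l"
      by (simp add: scale power2_eq_square divide_simps mult.commute)
    then show ?thesis using False
      by (simp add: divide_simps dot_square_norm mult.commute)
  qed (simp add: zero)
  define y where "y = f x - l *\<^sub>R x"
  have yS: "y \<in> S" unfolding y_def using x(1) S by (intro subspace_diff subspace_scale) auto
  have xx: "x \<bullet> x = 1" using x(2) by (simp add: dot_square_norm)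
  have "2 * (y \<bullet> y) = 0"
  proof (rule linear_dominated_by_quadratic_zero)
    fix t
    have "(x + t *\<^sub>R y) \<bullet> f (x + t *\<^sub>R y) \<le> l * ((x + t *\<^sub>R y) \<bullet> (x + t *\<^sub>R y))"
      using x(1) yS S(1) by (intro le subspace_add subspace_scale) auto
    moreover have "(x + t *\<^sub>R y) \<bullet> f (x + t *\<^sub>R y) = l + 2 * t * (f x \<bullet> y) + t\<^sup>2 * (y \<bullet> f y)"
      using sa[of y x] sa[of x y]
      by (simp add: add scale inner_simps l_def power2_eq_square algebra_simps inner_commute)
    moreover have "(x + t *\<^sub>R y) \<bullet> (x + t *\<^sub>R y) = 1 + 2 * t * (x \<bullet> y) + t\<^sup>2 * (y \<bullet> y)"
      using xx by (simp add: inner_simps power2_eq_square algebra_simps inner_commute)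
    moreover have "f x \<bullet> y = y \<bullet> y + l * (x \<bullet> y)"
      by (metis y_def diff_add_cancel inner_add_left inner_scaleR_left)
    ultimately have "l + 2 * t * (y \<bullet> y + l * (x \<bullet> y)) + t\<^sup>2 * (y \<bullet> f y)
        \<le> l * (1 + 2 * t * (x \<bullet> y) + t\<^sup>2 * (y \<bullet> y))"
      by metis
    then show "2 * (y \<bullet> y) * t \<le> (l * (y \<bullet> y) - y \<bullet> f y) * t\<^sup>2"
      by (simp add: algebra_simps)
  qed
  then have "f x = l *\<^sub>R x" by (simp add: y_def)
  with x that show thesis by blast
qed

text \<open>Eigenvectors are split off one at a time: by self-adjointness the orthogonal complement
  of an eigenvector in \<open>S\<close> is again invariant, and its dimension is one less.\<close>

theorem selfadjoint_eigenbasis: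
  fixes f :: "'a::euclidean_space \<Rightarrow> 'a"
  assumes lin: "linear f" and sa: "\<And>x y. f x \<bullet> y = x \<bullet> f y"
    and "subspace S" "f ` S \<subseteq> S"
  shows "\<exists>B l. B \<subseteq> S \<and> pairwise orthogonal B \<and> (\<forall>x\<in>B. norm x = 1 \<and> f x = l x *\<^sub>R x)
    \<and> card B = dim S \<and> finite B"
  using assms(3,4)
proof (induction "dim S" arbitrary: S rule: less_induct)
  case less
  show ?case
  proof (cases "S = {0}")
    case True
    then show ?thesis by (intro exI[of _ "{}"]) auto
  next
    case False
    obtain x l where x: "x \<in> S" "norm x = 1" "f x = l *\<^sub>R x"
      using selfadjoint_eigenvector[OF lin sa less.prems False] by blast
    \<comment> \<open>Phrased through \<open>span {x}\<close> to match the dimension formula for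
      orthogonal complements; \<open>S'_eq\<close> is the working form.\<close>
    define S' where "S' = {y \<in> S. \<forall>z\<in>span {x}. orthogonal z y}"
    have S'_eq: "S' = {y \<in> S. x \<bullet> y = 0}"
      by (auto simp: S'_def orthogonal_def span_singleton)
    have sub: "subspace S'"
      using less.prems(1) unfolding S'_eq subspace_def by (auto simp: inner_simps)
    have inv: "f ` S' \<subseteq> S'"
      using less.prems(2) sa[of x] x(3) by (auto simp: S'_eq simp flip: sa)
    have "span {x} \<subseteq> S" using x(1) less.prems(1) by (simp add: span_minimal)
    then have "dim S' + dim (span {x}) = dim S"
      using dim_subspace_orthogonal_to_vectors[of "span {x}" S] less.prems(1)
      by (simp add: S'_def)
    moreover have "dim (span {x}) = 1"
      using x(2) dim_eq_card_independent[of "{x}"] by (auto simp: dim_span)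
    ultimately have d: "dim S = Suc (dim S')" by simp
    then obtain B k where B: "B \<subseteq> S'" "pairwise orthogonal B"
      "\<forall>x\<in>B. norm x = 1 \<and> f x = k x *\<^sub>R x" "card B = dim S'" "finite B"
      using less.hyps[OF _ sub inv] by auto
    have xB: "x \<notin> B" using B(1) x(2) by (auto simp: S'_eq)
    have "pairwise orthogonal (insert x B)"
      using B(1,2) by (auto simp: pairwise_insert orthogonal_def S'_eq inner_commute)
    moreover have "insert x B \<subseteq> S" using x B(1) by (auto simp: S'_eq)
    moreover have "\<forall>y\<in>insert x B. norm y = 1 \<and> f y = (k(x := l)) y *\<^sub>R y"
      using x B(3) xB by auto
    ultimately show ?thesis using B(4,5) xB d
      by (intro exI[of _ "insert x B"] exI[of _ "k(x := l)"]) simp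
  qed
qed

text \<open>Indexing by the type \<open>'n\<close> itself lets the eigenvectors serve as columns of
  a square matrix.\<close>

lemma symmetric_matrix_eigenbasis:
  fixes M :: "real^'n^'n"
  assumes "transpose M = M"
  obtains v :: "'n \<Rightarrow> real^'n" and d :: "'n \<Rightarrow> real"
  where "\<And>i j. v i \<bullet> v j = (if i = j then 1 else 0)" "\<And>i. M *v v i = d i *\<^sub>R v i"
proof -
  have sa: "(M *v x) \<bullet> y = x \<bullet> (M *v y)" for x y
    by (metis assms dot_lmul_matrix transpose_matrix_vector)
  obtain B l where B: "pairwise orthogonal B" "\<forall>x\<in>B. norm x = 1 \<and> M *v x = l x *\<^sub>R x"
    "card B = dim (UNIV :: (real^'n) set)" "finite B"
    using selfadjoint_eigenbasis[of "(*v) M" UNIV, OF _ sa] by auto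
  have "card B = card (UNIV :: 'n set)" using B(3) by simp
  then obtain v where v: "bij_betw v (UNIV :: 'n set) B"
    using B(4) finite_same_card_bij[OF finite_class.finite_UNIV B(4)] by metis
  have vB: "v i \<in> B" for i using v by (auto simp: bij_betw_def)
  show thesis
  proof (rule that)
    show "v i \<bullet> v j = (if i = j then 1 else 0)" for i j
      using B(1,2) vB[of i] vB[of j] inj_eq[OF bij_betw_imp_inj_on[OF v], of i j]
      by (auto simp: dot_square_norm pairwise_def orthogonal_def)
    show "M *v v i = l (v i) *\<^sub>R v i" for i using B(2) vB by blast
  qed
qed

text \<open>With the eigenvectors as columns of \<open>Q\<close>, the identity
  \<open>CM ** Q = Q ** D\<close> is diagonalization carried out over the polynomial ring;
  orthonormality gives \<open>det Q \<noteq> 0\<close>, which cancels in this integral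
  domain.\<close>

lemma charpoly_eigenbasis:
  fixes M :: "real^'n^'n" and v :: "'n \<Rightarrow> real^'n" and d :: "'n \<Rightarrow> real"
  assumes on: "\<And>i j. v i \<bullet> v j = (if i = j then 1 else 0)"
    and ev: "\<And>i. M *v v i = d i *\<^sub>R v i"
  shows "charpoly M = (\<Prod>i\<in>UNIV. [:- d i, 1:])"
proof -
  define CM :: "real poly^'n^'n" where "CM = mat [:0, 1:] - (\<chi> i j. [:M $ i $ j:])"
  define Q :: "real poly^'n^'n" where "Q = (\<chi> i j. [:v j $ i:])"
  define D :: "real poly^'n^'n" where "D = (\<chi> i j. if i = j then [:- d i, 1:] else 0)"
  have const_sum: "[:\<Sum>k\<in>A. h k:] = (\<Sum>k\<in>A. [:h k:])" for A :: "'n set" and h :: "'n \<Rightarrow> real"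
    proof (induction A rule: infinite_finite_induct)
    case (insert x F)
    have "[:h x + sum h F:] = [:h x:] + [:sum h F:]" by simp
    then show ?case unfolding sum.insert[OF insert.hyps] insert.IH .
  qed auto
  have "transpose Q ** Q = mat 1"
  proof -
    have "(\<Sum>k\<in>UNIV. [:v i $ k:] * [:v j $ k:]) = (if i = j then 1 else 0)" for i j
    proof -
      have "(\<Sum>k\<in>UNIV. [:v i $ k:] * [:v j $ k:]) = [:v i \<bullet> v j:]"
        by (simp add: inner_vec_def const_sum mult.commute)
      then show ?thesis by (simp add: on one_pCons)
    qed
    then show ?thesis
      by (simp add: vec_eq_iff matrix_matrix_mult_def transpose_def Q_def mat_def)
  qed
  then have "det (transpose Q) * det Q = 1" by (metis det_mul det_I)
  then have "det Q \<noteq> 0" by auto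
  moreover have "CM ** Q = Q ** D"
  proof -
    have "(CM ** Q) $ i $ j = (Q ** D) $ i $ j" for i j
    proof -
      have "(CM ** Q) $ i $ j
          = (\<Sum>k\<in>UNIV. (if i = k then [:0, 1:] else 0) * [:v j $ k:]) - (\<Sum>k\<in>UNIV. [:M $ i $ k * v j $ k:])"
        by (simp add: matrix_matrix_mult_def CM_def Q_def mat_def algebra_simps
            flip: sum_subtractf)
      also have "(\<Sum>k\<in>UNIV. (if i = k then [:0, 1:] else 0) * [:v j $ k:]) = [:0, 1:] * [:v j $ i:]"
        by (subst sum.remove[of _ i]) (auto intro!: sum.neutral)
      also have "(\<Sum>k\<in>UNIV. [:M $ i $ k * v j $ k:]) = [:(M *v v j) $ i:]"
        by (simp add: matrix_vector_mult_def flip: const_sum)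
      also have "\<dots> = [:d j * v j $ i:]" by (simp add: ev)
      also have "[:0, 1:] * [:v j $ i:] - [:d j * v j $ i:] = [:v j $ i:] * [:- d j, 1:]"
        by simp
      also have "\<dots> = (Q ** D) $ i $ j"
        by (simp add: matrix_matrix_mult_def D_def Q_def if_distrib[of "\<lambda>x. _ * x"] sum.delta
            cong: if_cong)
      finally show ?thesis .
    qed
    then show ?thesis by (simp add: vec_eq_iff)
  qed
  then have "det CM * det Q = det Q * det D" by (metis det_mul)
  ultimately have "det CM = det D" by simp
  also have "\<dots> = (\<Prod>i\<in>UNIV. [:- d i, 1:])"
    by (subst det_diagonal) (simp_all add: D_def)
  finally show ?thesis by (simp add: charpoly_def CM_def)
qed

text \<open>Lifts a reordering of values to a reordering of their sources, so that eigenvectors can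
  be listed in the order of the sorted singular values.\<close>

lemma mset_eq_map_obtain:
  assumes "mset xs = mset (map f ys)"
  obtains zs where "xs = map f zs" "mset zs = mset ys"
proof -
  have "\<exists>zs. xs = map f zs \<and> mset zs = M" if "image_mset f M = mset xs" for M
    using that
  proof (induction xs arbitrary: M)
    case (Cons x xs)
    then obtain y N where "M = add_mset y N" "x = f y" "image_mset f N = mset xs"
      using msed_map_invR[of f M x "mset xs"] by auto
    with Cons.IH[of N] obtain zs where "xs = map f zs" "mset zs = N" by blast
    with \<open>M = _\<close> \<open>x = _\<close> show ?case by (intro exI[of _ "y # zs"]) simp
  qed simp
  from this[of "mset ys"] assms that show thesis by auto
qed

section \<open>Singular value decomposition\<close>

lemma inner_gram:
  fixes z :: "real^'q^'p"
  shows "x \<bullet> ((transpose z ** z) *v y) = (z *v x) \<bullet> (z *v y)"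
  by (metis dot_lmul_matrix inner_commute matrix_vector_mul_assoc transpose_matrix_vector)

text \<open>Indices start at 0 here, and \<open>w i\<close> is \<open>0\<close> when the corresponding singular value vanishes,
  so that no completion to an orthonormal system of left singular vectors is needed.\<close>
definition is_svd :: "real^'q^'p \<Rightarrow> (nat \<Rightarrow> real^'q) \<Rightarrow> (nat \<Rightarrow> real^'p) \<Rightarrow> bool" where
  "is_svd z v w \<longleftrightarrow>
     (\<forall>i<CARD('q). \<forall>j<CARD('q). v i \<bullet> v j = (if i = j then 1 else 0)) \<and>
     (\<forall>i<CARD('q). \<forall>j<CARD('q). w i \<bullet> w j = (if i = j \<and> sigma (Suc i) z \<noteq> 0 then 1 else 0)) \<and>
     (\<forall>i<CARD('q). z *v v i = sigma (Suc i) z *\<^sub>R w i)"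

text \<open>Right singular vectors are eigenvectors of the Gram matrix, left ones their normalized
  images. The factored characteristic polynomial identifies its roots with the eigenvalues
  \<open>d\<close>.\<close>

theorem svd:
  fixes z :: "real^'q^'p"
  shows svd_exists: "\<exists>v w. is_svd z v w"
    and sigma_nonneg: "i < CARD('q) \<Longrightarrow> 0 \<le> sigma (Suc i) z"
    and sigma_antimono: "i \<le> j \<Longrightarrow> j < CARD('q) \<Longrightarrow> sigma (Suc j) z \<le> sigma (Suc i) z"
proof -
  define q where "q = CARD('q)"
  define M where "M = transpose z ** z"
  have "transpose M = M" by (simp add: M_def matrix_transpose_mul)
  then obtain v :: "'q \<Rightarrow> real^'q" and d where on: "\<And>i j. v i \<bullet> v j = (if i = j then 1 else 0)"
    and ev: "\<And>i. M *v v i = d i *\<^sub>R v i"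
    using symmetric_matrix_eigenbasis by blast
  have zz: "(z *v v i) \<bullet> (z *v v j) = (if i = j then d i else 0)" for i j
    using inner_gram[of "v i" z "v j"] ev[of j] on[of i j] by (auto simp: M_def)
  have d0: "0 \<le> d i" for i using zz[of i i] by (metis inner_ge_zero)
  obtain ys :: "'q list" where ys: "set ys = UNIV" "distinct ys"
    using finite_distinct_list[of "UNIV :: 'q set"] by auto
  define f where "f = (\<lambda>i. sqrt (d i))"
  have "proots (charpoly M) = (\<Sum>i\<in>UNIV. {#d i#})"
    by (subst charpoly_eigenbasis[OF on ev], subst proots_prod) auto
  also have "\<dots> = image_mset d (mset_set UNIV)"
    by (simp add: sum_unfold_sum_mset)
  finally have "mset (singular_values z) = image_mset f (mset_set UNIV)"
    by (simp add: singular_values_def M_def f_def image_mset.compositionality comp_def)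
  also have "mset_set UNIV = mset ys" using ys by (metis mset_set_set)
  finally have "mset (singular_values z) = mset (map f ys)" by simp
  \<comment> \<open>\<open>zs\<close> enumerates the eigenvector indices in the order in which their
    values \<open>f\<close> occur in \<open>singular_values\<close>, hence by decreasing singular
    value.\<close>
  then obtain zs where zs: "singular_values z = map f zs" "mset zs = mset ys"
    by (rule mset_eq_map_obtain)
  have dz: "distinct zs" and lz: "length zs = q"
    using zs(2) ys by (metis mset_eq_imp_distinct_iff) (metis distinct_card mset_eq_length q_def ys zs(2))
  have dec: "sorted (rev (singular_values z))" by (simp add: singular_values_def)
  have sg: "sigma (Suc i) z = f (zs ! i)" if "i < CARD('q)" for i
    using that lz by (simp add: sigma_def zs(1) q_def)
  show "i < CARD('q) \<Longrightarrow> 0 \<le> sigma (Suc i) z" by (simp add: sg f_def d0)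
  show "i \<le> j \<Longrightarrow> j < CARD('q) \<Longrightarrow> sigma (Suc j) z \<le> sigma (Suc i) z"
    using dec lz by (auto simp: sg zs(1) q_def sorted_rev_iff_nth_mono)
  \<comment> \<open>By \<open>zz\<close>, \<open>f\<close> is the length of the image
    \<open>z *v v\<close>. If it is zero, the image vanishes too, so the zero vector still satisfies
    the defining equation.\<close>
  let ?w = "\<lambda>i. if d (zs ! i) = 0 then 0 else (z *v v (zs ! i)) /\<^sub>R f (zs ! i)"
  have "is_svd z (\<lambda>i. v (zs ! i)) ?w"
    unfolding is_svd_def
  proof (intro conjI allI impI)
    fix i j assume i: "i < CARD('q)" and j: "j < CARD('q)"
    then have ij: "zs ! i = zs ! j \<longleftrightarrow> i = j"
      using dz lz by (simp add: nth_eq_iff_index_eq q_def)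
    show "v (zs ! i) \<bullet> v (zs ! j) = (if i = j then 1 else 0)" by (simp add: on ij)
    have "f (zs ! j) * f (zs ! j) = d (zs ! j)" using d0 by (simp add: f_def)
    then show "?w i \<bullet> ?w j = (if i = j \<and> sigma (Suc i) z \<noteq> 0 then 1 else 0)"
      using ij by (auto simp: sg[OF i] zz f_def field_simps)
  next
    fix i assume i: "i < CARD('q)"
    show "z *v v (zs ! i) = sigma (Suc i) z *\<^sub>R ?w i"
      using zz[of "zs ! i" "zs ! i"] by (auto simp: sg[OF i] f_def)
  qed
  then show "\<exists>v w. is_svd z v w" by blast
qed

lemma is_svdD:
  fixes z :: "real^'q^'p"
  assumes "is_svd z v w" "i < CARD('q)"
  shows "j < CARD('q) \<Longrightarrow> v i \<bullet> v j = (if i = j then 1 else 0)"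
    and "j < CARD('q) \<Longrightarrow> w i \<bullet> w j = (if i = j \<and> sigma (Suc i) z \<noteq> 0 then 1 else 0)"
    and "z *v v i = sigma (Suc i) z *\<^sub>R w i"
  using assms unfolding is_svd_def by blast+

subsection \<open>Ky Fan norms\<close>

text \<open>Equivalently, the matrix with rows \<open>a i\<close> has spectral norm at most \<open>1\<close>.\<close>
definition bessel_family :: "'i set \<Rightarrow> ('i \<Rightarrow> 'a::real_inner) \<Rightarrow> bool" where
  "bessel_family I a \<longleftrightarrow> finite I \<and> (\<forall>x. (\<Sum>i\<in>I. (a i \<bullet> x)\<^sup>2) \<le> (norm x)\<^sup>2)"

section \<open>Bessel families and orthonormal systems\<close>

lemma bessel_familyD:
  assumes "bessel_family I a"
  shows "finite I" "(\<Sum>i\<in>I. (a i \<bullet> x)\<^sup>2) \<le> (norm x)\<^sup>2"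
  using assms by (auto simp: bessel_family_def)

text \<open>Testing the Bessel inequality on \<open>a i\<close> itself gives
  \<open>t * t \<le> t\<close> for its squared length \<open>t\<close>.\<close>

lemma bessel_family_norm_le:
  assumes "bessel_family I a" "i \<in> I"
  shows "(norm (a i))\<^sup>2 \<le> 1"
proof -
  let ?t = "(norm (a i))\<^sup>2"
  have "?t\<^sup>2 = (a i \<bullet> a i)\<^sup>2" by (simp add: dot_square_norm)
  also have "\<dots> \<le> (\<Sum>j\<in>I. (a j \<bullet> a i)\<^sup>2)"
    using assms by (intro member_le_sum) (auto dest: bessel_familyD)
  also have "\<dots> \<le> ?t" using assms(1) by (rule bessel_familyD)
  finally have le: "?t * ?t \<le> 1 * ?t" by (simp add: power2_eq_square)
  show ?thesis
  proof (cases "?t = 0")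
    case False
    then have "0 < ?t" by simp
    with le show ?thesis by (rule mult_right_le_imp_le)
  qed simp
qed

lemma bessel_family_sum_norm_le:
  assumes "bessel_family I a"
  shows "(\<Sum>i\<in>I. (norm (a i))\<^sup>2) \<le> card I"
  using sum_mono[of I "\<lambda>i. (norm (a i))\<^sup>2" "\<lambda>_. 1"] bessel_family_norm_le[OF assms] by simp

text \<open>Bessel's inequality, by expanding the square of \<open>x - ?y\<close> with
  \<open>x \<bullet> ?y = ?S\<close> and \<open>?y \<bullet> ?y \<le> ?S\<close>. Lengths below
  \<open>1\<close> are allowed so that vanishing left singular vectors fit in.\<close>

lemma bessel_family_orthogonal:
  assumes "finite I" and orth: "\<And>i j. i \<in> I \<Longrightarrow> j \<in> I \<Longrightarrow> i \<noteq> j \<Longrightarrow> a i \<bullet> a j = 0"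
    and le1: "\<And>i. i \<in> I \<Longrightarrow> a i \<bullet> a i \<le> 1"
  shows "bessel_family I a"
  unfolding bessel_family_def
proof (intro conjI allI)
  fix x
  let ?y = "\<Sum>i\<in>I. (a i \<bullet> x) *\<^sub>R a i"
  let ?S = "\<Sum>i\<in>I. (a i \<bullet> x)\<^sup>2"
  have "?y \<bullet> ?y = (\<Sum>i\<in>I. \<Sum>j\<in>I. (a i \<bullet> x) * (a j \<bullet> x) * (a i \<bullet> a j))"
    by (simp add: inner_sum_left inner_sum_right sum_distrib_left mult.assoc mult.left_commute
        inner_commute)
  also have "\<dots> = (\<Sum>i\<in>I. (a i \<bullet> x)\<^sup>2 * (a i \<bullet> a i))"
  proof (intro sum.cong refl)
    fix i assume i: "i \<in> I"
    have "(\<Sum>j\<in>I. (a i \<bullet> x) * (a j \<bullet> x) * (a i \<bullet> a j))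
        = (\<Sum>j\<in>{i}. (a i \<bullet> x) * (a j \<bullet> x) * (a i \<bullet> a j))"
      using i orth[of i] by (intro sum.mono_neutral_right) (auto simp: assms(1))
    then show "(\<Sum>j\<in>I. (a i \<bullet> x) * (a j \<bullet> x) * (a i \<bullet> a j)) = (a i \<bullet> x)\<^sup>2 * (a i \<bullet> a i)"
      by (simp add: power2_eq_square)
  qed
  also have "\<dots> \<le> ?S"
    using le1 by (intro sum_mono) (simp add: mult_left_le)
  finally have "?y \<bullet> ?y \<le> ?S" .
  moreover have "x \<bullet> ?y = ?S"
    by (simp add: inner_sum_right power2_eq_square inner_commute)
  moreover have "0 \<le> (x - ?y) \<bullet> (x - ?y)" by (rule inner_ge_zero)
  then have "0 \<le> x \<bullet> x - 2 * (x \<bullet> ?y) + ?y \<bullet> ?y"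
    by (simp only: inner_diff_left inner_diff_right) (simp add: inner_commute)
  ultimately show "?S \<le> (norm x)\<^sup>2" by (simp add: dot_square_norm)
qed (fact assms(1))

text \<open>The \<open>b i\<close> are images of the \<open>a i\<close> under the adjoint of a
  contraction \<open>L\<close>, expressed by testing against \<open>x\<close> so that no adjoint has
  to be constructed.\<close>

lemma bessel_family_comp:
  assumes "bessel_family I a" "\<And>i x. i \<in> I \<Longrightarrow> b i \<bullet> x = a i \<bullet> L x" "\<And>x. norm (L x) \<le> norm x"
  shows "bessel_family I b"
  unfolding bessel_family_def
proof (intro conjI allI)
  show "finite I" using assms(1) by (rule bessel_familyD)
  fix x
  have "(\<Sum>i\<in>I. (b i \<bullet> x)\<^sup>2) = (\<Sum>i\<in>I. (a i \<bullet> L x)\<^sup>2)"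
    using assms(2) by (intro sum.cong) auto
  also have "\<dots> \<le> (norm (L x))\<^sup>2" using assms(1) by (rule bessel_familyD)
  also have "\<dots> \<le> (norm x)\<^sup>2" using assms(3) by (intro power_mono) auto
  finally show "(\<Sum>i\<in>I. (b i \<bullet> x)\<^sup>2) \<le> (norm x)\<^sup>2" .
qed

lemma parseval:
  fixes B :: "'a::real_inner set"
  assumes "finite B" "pairwise orthogonal B" "\<And>b. b \<in> B \<Longrightarrow> norm b = 1" "x \<in> span B"
  shows "(norm x)\<^sup>2 = (\<Sum>b\<in>B. (b \<bullet> x)\<^sup>2)"
proof -
  obtain c where x: "x = (\<Sum>b\<in>B. c b *\<^sub>R b)"
    using assms(1,4) by (auto simp: span_finite)
  have bx: "b \<bullet> x = c b" if "b \<in> B" for b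
  proof -
    have "b \<bullet> x = (\<Sum>b'\<in>B. c b' * (b \<bullet> b'))" by (simp add: x inner_sum_right)
    also have "\<dots> = (\<Sum>b'\<in>{b}. c b' * (b \<bullet> b'))"
      using that assms(1,2) by (intro sum.mono_neutral_right) (auto simp: pairwise_def orthogonal_def)
    finally show ?thesis using assms(3)[OF that] by (simp add: dot_square_norm)
  qed
  have "(norm x)\<^sup>2 = x \<bullet> (\<Sum>b\<in>B. c b *\<^sub>R b)" using x by (simp add: dot_square_norm)
  also have "\<dots> = (\<Sum>b\<in>B. c b * (b \<bullet> x))" by (simp add: inner_sum_right inner_commute)
  also have "\<dots> = (\<Sum>b\<in>B. (b \<bullet> x)\<^sup>2)"
    using bx by (intro sum.cong) (auto simp: power2_eq_square)
  finally show ?thesis .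
qed

lemma bessel_family_orthonormal_set:
  assumes "finite B" "pairwise orthogonal B" "\<And>b. b \<in> B \<Longrightarrow> norm b = 1"
  shows "bessel_family B (\<lambda>b. b)"
  using assms by (intro bessel_family_orthogonal) (auto simp: pairwise_def orthogonal_def dot_square_norm)

section \<open>Sums of leading singular values as maxima\<close>

lemma sum_top_weights:
  fixes \<sigma> t :: "nat \<Rightarrow> real"
  assumes dec: "\<And>i j. i \<le> j \<Longrightarrow> j < n \<Longrightarrow> \<sigma> j \<le> \<sigma> i" and nn: "\<And>i. i < n \<Longrightarrow> 0 \<le> \<sigma> i"
    and t: "\<And>i. i < n \<Longrightarrow> 0 \<le> t i" "\<And>i. i < n \<Longrightarrow> t i \<le> 1" and sum: "(\<Sum>i<n. t i) \<le> real k"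
  shows "(\<Sum>i<n. \<sigma> i * t i) \<le> (\<Sum>i<min k n. \<sigma> i)"
proof (cases "k < n")
  case True
  have split: "(\<Sum>i<n. g i) = (\<Sum>i<k. g i) + (\<Sum>i=k..<n. g i)" for g :: "nat \<Rightarrow> real"
    using True by (simp add: lessThan_atLeast0 sum.atLeastLessThan_concat)
  \<comment> \<open>Exchange at the threshold \<open>\<sigma> k\<close>: weight missing below
    \<open>k\<close> is worth at least \<open>\<sigma> k\<close> per unit, weight placed from
    \<open>k\<close> on at most that, and by the budget the latter weight does not exceed the
    former.\<close>
  have "(\<Sum>i<k. \<sigma> k * (1 - t i)) \<le> (\<Sum>i<k. \<sigma> i * (1 - t i))"
    using True t dec by (intro sum_mono mult_right_mono) auto
  moreover have "(\<Sum>i=k..<n. \<sigma> i * t i) \<le> (\<Sum>i=k..<n. \<sigma> k * t i)"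
    using True t dec by (intro sum_mono mult_right_mono) auto
  moreover have "\<sigma> k * (\<Sum>i<n. t i) \<le> \<sigma> k * k"
    using sum nn True by (intro mult_left_mono) auto
  ultimately show ?thesis
    using True split[of t] split[of "\<lambda>i. \<sigma> i * t i"]
    by (simp add: sum_subtractf right_diff_distrib sum_distrib_left[symmetric] distrib_left
        mult.commute[of "\<sigma> k" "real k"])
next
  case False
  then have "min k n = n" by simp
  moreover have "(\<Sum>i<n. \<sigma> i * t i) \<le> (\<Sum>i<n. \<sigma> i)"
    using t nn by (intro sum_mono) (simp add: mult_left_le)
  ultimately show ?thesis by simp
qed

lemma Sigma_sum_eq:
  "Sigma_sum k z = (\<Sum>i<min k CARD('q). sigma (Suc i) z)" for z :: "real^'q^'p"
  unfolding Sigma_sum_def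
  by (rule sum.reindex_bij_witness[of _ Suc "\<lambda>i. i - 1"]) auto

lemma nuclear_norm_eq_Sigma_sum:
  "CARD('q) \<le> k \<Longrightarrow> nuclear_norm z = Sigma_sum k z" for z :: "real^'q^'p"
  by (simp add: nuclear_norm_def Sigma_sum_def min_absorb2)

text \<open>The residual is orthogonal to \<open>q\<close> independent vectors, hence to the whole
  space and to itself.\<close>

lemma orthonormal_expansion:
  fixes v :: "nat \<Rightarrow> real^'q"
  assumes "\<And>i j. i < CARD('q) \<Longrightarrow> j < CARD('q) \<Longrightarrow> v i \<bullet> v j = (if i = j then 1 else 0)"
  shows "x = (\<Sum>i<CARD('q). (v i \<bullet> x) *\<^sub>R v i)"
proof -
  let ?B = "v ` {..<CARD('q)}"
  have inj: "inj_on v {..<CARD('q)}"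
    by (intro inj_onI) (metis assms lessThan_iff zero_neq_one)
  have orth: "pairwise orthogonal ?B"
    using assms by (auto simp: pairwise_def orthogonal_def)
  have "0 \<notin> ?B"
  proof
    assume "0 \<in> ?B"
    then obtain i where "i < CARD('q)" "v i = 0" by auto
    with assms[of i i] show False by simp
  qed
  then have "independent ?B" using orth by (intro pairwise_orthogonal_independent)
  moreover have "card ?B = dim (UNIV :: (real^'q) set)" using inj by (simp add: card_image)
  ultimately have "span ?B = UNIV"
    using card_eq_dim[of ?B UNIV] by auto
  let ?y = "\<Sum>i<CARD('q). (v i \<bullet> x) *\<^sub>R v i"
  have "orthogonal (x - ?y) (v j)" if "j < CARD('q)" for j
    using that assms
    by (simp add: orthogonal_def inner_diff_left inner_sum_left inner_commute[of x] if_distrib[of "\<lambda>t. _ * t"] cong: if_cong)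
  then have "orthogonal (x - ?y) (x - ?y)"
    using \<open>span ?B = UNIV\<close> orthogonal_to_span[of "x - ?y" ?B "x - ?y"] by auto
  then show ?thesis by (simp add: orthogonal_def)
qed

lemma is_svd_mult:
  fixes z :: "real^'q^'p"
  assumes svd: "is_svd z v w"
  shows "z *v x = (\<Sum>j<CARD('q). (sigma (Suc j) z * (v j \<bullet> x)) *\<^sub>R w j)"
  by (subst orthonormal_expansion[OF is_svdD(1)[OF svd], of x])
    (simp_all add: linear_sum[OF matrix_vector_mul_linear] matrix_vector_mult_scaleR
      is_svdD(3)[OF svd] mult.commute)

text \<open>Upper half of the Ky Fan maximum principle. Expanding \<open>z\<close> by its singular
  values leaves a weighted sum of them. The weights are at most \<open>1\<close> by the Bessel
  property of \<open>a\<close>, \<open>b\<close> at the singular vectors, and their total is at most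
  \<open>k\<close> by the Bessel property of \<open>v\<close>, \<open>w\<close> at the
  \<open>a i\<close>, \<open>b i\<close>.\<close>

theorem inner_sum_le_Sigma_sum:
  fixes z :: "real^'q^'p"
  assumes a: "bessel_family I a" "(\<Sum>i\<in>I. (norm (a i))\<^sup>2) \<le> real k"
    and b: "bessel_family I b" "(\<Sum>i\<in>I. (norm (b i))\<^sup>2) \<le> real k"
  shows "(\<Sum>i\<in>I. a i \<bullet> (z *v b i)) \<le> Sigma_sum k z"
proof -
  obtain v w where svd: "is_svd z v w" using svd_exists by blast
  note v = is_svdD(1)[OF svd] and w = is_svdD(2)[OF svd]
  have bv: "bessel_family {..<CARD('q)} v" and bw: "bessel_family {..<CARD('q)} w"
    by (rule bessel_family_orthogonal; simp add: v w)+
  \<comment> \<open>The weight of the \<open>j\<close>-th singular value after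
    \<open>x * y \<le> (x^2 + y^2) / 2\<close> has separated \<open>a\<close> from
    \<open>b\<close>.\<close>
  define t where "t j = (\<Sum>i\<in>I. ((a i \<bullet> w j)\<^sup>2 + (b i \<bullet> v j)\<^sup>2) / 2)" for j
  note zx = is_svd_mult[OF svd]
  have amgm: "x * y \<le> (x\<^sup>2 + y\<^sup>2) / 2" for x y :: real 
    using zero_le_power2[of "x - y"] by (simp add: power2_diff)
  have "(\<Sum>i\<in>I. a i \<bullet> (z *v b i)) = (\<Sum>i\<in>I. \<Sum>j<CARD('q). sigma (Suc j) z * ((a i \<bullet> w j) * (b i \<bullet> v j)))"
    by (simp add: zx inner_sum_right inner_commute[of "v _"] mult_ac)
  also have "\<dots> = (\<Sum>j<CARD('q). sigma (Suc j) z * (\<Sum>i\<in>I. (a i \<bullet> w j) * (b i \<bullet> v j)))"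
    by (subst sum.swap) (simp add: sum_distrib_left)
  also have "\<dots> \<le> (\<Sum>j<CARD('q). sigma (Suc j) z * t j)"
    unfolding t_def
    by (intro sum_mono mult_left_mono amgm) (auto simp: sigma_nonneg)
  also have "\<dots> \<le> (\<Sum>j<min k CARD('q). sigma (Suc j) z)"
  proof (rule sum_top_weights)
    show "0 \<le> t j" for j by (auto simp: t_def intro!: sum_nonneg)
    fix j assume j: "j < CARD('q)"
    have "(norm (w j))\<^sup>2 \<le> 1" "(norm (v j))\<^sup>2 \<le> 1"
      using bessel_family_norm_le[OF bw] bessel_family_norm_le[OF bv] j by simp_all
    then have "(\<Sum>i\<in>I. (a i \<bullet> w j)\<^sup>2) + (\<Sum>i\<in>I. (b i \<bullet> v j)\<^sup>2) \<le> 1 + 1"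
      by (intro add_mono order_trans[OF bessel_familyD(2)[OF a(1)]]
          order_trans[OF bessel_familyD(2)[OF b(1)]])
    then show "t j \<le> 1"
      by (simp add: t_def sum_divide_distrib[symmetric] sum.distrib)
  next
    have "(\<Sum>j<CARD('q). t j)
        = ((\<Sum>i\<in>I. \<Sum>j<CARD('q). (w j \<bullet> a i)\<^sup>2) + (\<Sum>i\<in>I. \<Sum>j<CARD('q). (v j \<bullet> b i)\<^sup>2)) / 2"
      unfolding t_def
      by (subst sum.swap) (simp add: sum_divide_distrib[symmetric] sum.distrib inner_commute)
    also have "\<dots> \<le> ((\<Sum>i\<in>I. (norm (a i))\<^sup>2) + (\<Sum>i\<in>I. (norm (b i))\<^sup>2)) / 2"
      by (intro divide_right_mono add_mono sum_mono bessel_familyD bv bw) simp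
    also have "\<dots> \<le> k" using a(2) b(2) by simp
    finally show "(\<Sum>j<CARD('q). t j) \<le> k" .
  qed (simp_all add: sigma_nonneg sigma_antimono)
  also have "\<dots> = Sigma_sum k z" by (rule Sigma_sum_eq[symmetric])
  finally show ?thesis .
qed

text \<open>The leading singular vectors attain the bound. Where \<open>w i\<close> is zero the term
  is zero, and so is the singular value.\<close>

theorem Sigma_sum_attained:
  fixes z :: "real^'q^'p"
  obtains I :: "nat set" and a b where "bessel_family I a" "(\<Sum>i\<in>I. (norm (a i))\<^sup>2) \<le> real k"
    "bessel_family I b" "(\<Sum>i\<in>I. (norm (b i))\<^sup>2) \<le> real k"
    "Sigma_sum k z = (\<Sum>i\<in>I. a i \<bullet> (z *v b i))"
proof -
  obtain v w where svd: "is_svd z v w" using svd_exists by blast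
  note v = is_svdD(1)[OF svd] and w = is_svdD(2)[OF svd] and zv = is_svdD(3)[OF svd]
  let ?I = "{..<min k CARD('q)}"
  have bv: "bessel_family ?I v" and bw: "bessel_family ?I w"
    by (rule bessel_family_orthogonal; simp add: v w)+
  have "Sigma_sum k z = (\<Sum>i\<in>?I. w i \<bullet> (z *v v i))"
    unfolding Sigma_sum_eq by (intro sum.cong) (auto simp: zv w)
  moreover have "real (card ?I) \<le> k" by simp
  ultimately show thesis
    using bv bw bessel_family_sum_norm_le[OF bv] bessel_family_sum_norm_le[OF bw]
    by (intro that[of ?I w v]) linarith+
qed

lemma inner_sum_le_nuclear_norm:
  fixes z :: "real^'q^'p"
  assumes "bessel_family I a" "bessel_family I b"
  shows "(\<Sum>i\<in>I. a i \<bullet> (z *v b i)) \<le> nuclear_norm z"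
proof -
  \<comment> \<open>Large enough that the length budgets hold by
    \<open>bessel_family_sum_norm_le\<close> and that \<open>Sigma_sum ?k\<close> is the nuclear
    norm.\<close>
  let ?k = "CARD('q) + card I"
  have "(\<Sum>i\<in>I. a i \<bullet> (z *v b i)) \<le> Sigma_sum ?k z"
    using assms[THEN bessel_family_sum_norm_le] by (intro inner_sum_le_Sigma_sum assms) auto
  then show ?thesis by (simp add: nuclear_norm_eq_Sigma_sum[of ?k])
qed

lemma nuclear_norm_attained:
  fixes z :: "real^'q^'p"
  obtains I :: "nat set" and a b where "bessel_family I a" "bessel_family I b"
    "nuclear_norm z = (\<Sum>i\<in>I. a i \<bullet> (z *v b i))"
  using Sigma_sum_attained[of "CARD('q)" z] nuclear_norm_eq_Sigma_sum[of "CARD('q)" z]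
  by (metis order_refl)

section \<open>Norm axioms\<close>

lemma Sigma_sum_nonneg: "0 \<le> Sigma_sum k z"
  using inner_sum_le_Sigma_sum[of "{}" _ k _ z] by (auto simp: bessel_family_def)

text \<open>A maximum of linear functionals is subadditive: the optimal pair for
  \<open>x + y\<close> competes for each summand.\<close>

lemma Sigma_sum_triangle: "Sigma_sum k (x + y) \<le> Sigma_sum k x + Sigma_sum k y"
proof -
  obtain I :: "nat set" and a b where ab: "bessel_family I a" "(\<Sum>i\<in>I. (norm (a i))\<^sup>2) \<le> real k"
    "bessel_family I b" "(\<Sum>i\<in>I. (norm (b i))\<^sup>2) \<le> real k"
    and eq: "Sigma_sum k (x + y) = (\<Sum>i\<in>I. a i \<bullet> ((x + y) *v b i))"
    using Sigma_sum_attained by blast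
  have "Sigma_sum k (x + y) = (\<Sum>i\<in>I. a i \<bullet> (x *v b i)) + (\<Sum>i\<in>I. a i \<bullet> (y *v b i))"
    by (simp add: eq matrix_vector_mult_add_rdistrib inner_add_right sum.distrib)
  also have "\<dots> \<le> Sigma_sum k x + Sigma_sum k y"
    by (intro add_mono inner_sum_le_Sigma_sum ab)
  finally show ?thesis .
qed

text \<open>The sign of \<open>c\<close> is absorbed into \<open>a\<close>, which stays
  admissible.\<close>

lemma Sigma_sum_scaleR_le: "Sigma_sum k (c *\<^sub>R z) \<le> \<bar>c\<bar> * Sigma_sum k z"
proof -
  obtain I :: "nat set" and a b where ab: "bessel_family I a" "(\<Sum>i\<in>I. (norm (a i))\<^sup>2) \<le> real k"
    "bessel_family I b" "(\<Sum>i\<in>I. (norm (b i))\<^sup>2) \<le> real k"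
    and eq: "Sigma_sum k (c *\<^sub>R z) = (\<Sum>i\<in>I. a i \<bullet> ((c *\<^sub>R z) *v b i))"
    using Sigma_sum_attained by blast
  have s: "bessel_family I (\<lambda>i. sgn c *\<^sub>R a i)"
    using ab(1) by (rule bessel_family_comp[where L = "\<lambda>x. sgn c *\<^sub>R x"]) (auto simp: abs_sgn_eq)
  have "(\<Sum>i\<in>I. (norm (sgn c *\<^sub>R a i))\<^sup>2) \<le> (\<Sum>i\<in>I. (norm (a i))\<^sup>2)"
    by (intro sum_mono) (auto simp: abs_sgn_eq)
  with ab(2) have s2: "(\<Sum>i\<in>I. (norm (sgn c *\<^sub>R a i))\<^sup>2) \<le> real k" by linarith
  have "Sigma_sum k (c *\<^sub>R z) = (\<Sum>i\<in>I. \<bar>c\<bar> * (sgn c *\<^sub>R a i \<bullet> (z *v b i)))"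
    by (simp add: eq scaleR_matrix_vector_assoc[symmetric] mult.assoc[symmetric] abs_mult_sgn)
  also have "\<dots> = \<bar>c\<bar> * (\<Sum>i\<in>I. sgn c *\<^sub>R a i \<bullet> (z *v b i))"
    by (rule sum_distrib_left[symmetric])
  also have "\<dots> \<le> \<bar>c\<bar> * Sigma_sum k z"
    by (intro mult_left_mono inner_sum_le_Sigma_sum s s2 ab) auto
  finally show ?thesis .
qed

lemma Sigma_sum_scaleR: "Sigma_sum k (c *\<^sub>R z) = \<bar>c\<bar> * Sigma_sum k z"
proof (cases "c = 0")
  case True
  then show ?thesis using Sigma_sum_scaleR_le[of k c z] Sigma_sum_nonneg[of k "c *\<^sub>R z"] by simp
next
  case False
  have "Sigma_sum k z \<le> \<bar>inverse c\<bar> * Sigma_sum k (c *\<^sub>R z)"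
    using Sigma_sum_scaleR_le[of k "inverse c" "c *\<^sub>R z"] False by simp
  then have "\<bar>c\<bar> * Sigma_sum k z \<le> Sigma_sum k (c *\<^sub>R z)"
    using False by (simp add: field_simps)
  then show ?thesis using Sigma_sum_scaleR_le[of k c z] by simp
qed

text \<open>For \<open>k \<ge> 1\<close> the sum contains the largest singular value, and this one
  dominates all the others.\<close>

lemma Sigma_sum_eq_0D:
  fixes z :: "real^'q^'p"
  assumes "Sigma_sum k z = 0" "k \<ge> 1"
  shows "z = 0"
proof -
  obtain v w where svd: "is_svd z v w" using svd_exists by blast
  have "(\<Sum>i<min k CARD('q). sigma (Suc i) z) = 0" using assms(1) by (simp add: Sigma_sum_eq)
  then have "sigma (Suc 0) z = 0"
    using sigma_nonneg assms(2) by (subst (asm) sum_nonneg_eq_0_iff) (auto simp: Suc_le_eq)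
  then have zero: "sigma (Suc i) z = 0" if "i < CARD('q)" for i
    using sigma_antimono[of 0 i z] sigma_nonneg[of i z] that by simp
  have "z *v x = 0" for x
    unfolding is_svd_mult[OF svd] by (intro sum.neutral) (simp add: zero)
  then show ?thesis by (simp add: matrix_eq)
qed

lemma is_seminorm_Sigma_sum: "is_seminorm (Sigma_sum k)"
  by (simp add: is_seminorm_def Sigma_sum_nonneg Sigma_sum_scaleR Sigma_sum_triangle)

lemma is_norm_Sigma_sum: "k \<ge> 1 \<Longrightarrow> is_norm (Sigma_sum k)"
  using Sigma_sum_eq_0D by (auto simp: is_norm_def is_seminorm_Sigma_sum)

lemma is_norm_nuclear_norm: "is_norm (nuclear_norm :: real^'q^'p \<Rightarrow> real)"
proof -
  have "(nuclear_norm :: real^'q^'p \<Rightarrow> real) = Sigma_sum CARD('q)"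
    using nuclear_norm_eq_Sigma_sum[where k = "CARD('q)"] by auto
  moreover have "is_norm (Sigma_sum CARD('q) :: real^'q^'p \<Rightarrow> real)"
    by (rule is_norm_Sigma_sum) (simp add: Suc_le_eq)
  ultimately show ?thesis by simp
qed

subsection \<open>Orthoprojectors\<close>

lemma orthoprojector_inner:
  assumes "orthoprojector M"
  shows "(M *v x) \<bullet> y = x \<bullet> (M *v y)"
  using assms unfolding orthoprojector_def by (metis dot_lmul_matrix transpose_matrix_vector)

lemma orthoprojector_idem: "orthoprojector M \<Longrightarrow> M *v (M *v x) = M *v x"
  by (simp add: orthoprojector_def matrix_vector_mul_assoc)

lemma orthoprojector_diff:
  fixes M :: "real^'n^'n"
  assumes "orthoprojector M"
  shows "orthoprojector (mat 1 - M)"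
proof -
  have "(mat 1 - M) *v ((mat 1 - M) *v x) = (mat 1 - M) *v x" for x
    using orthoprojector_idem[OF assms]
    by (simp add: matrix_vector_mult_diff_rdistrib matrix_vector_mult_diff_distrib)
  moreover have "transpose (mat 1 - M) = mat 1 - transpose M"
    by (simp add: transpose_def mat_def vec_eq_iff)
  moreover have "transpose M = M" using assms by (simp add: orthoprojector_def)
  ultimately show ?thesis
    by (simp add: orthoprojector_def matrix_eq[of "(mat 1 - M) ** (mat 1 - M)"]
        matrix_vector_mul_assoc[symmetric])
qed

lemma orthoprojector_pythagoras:
  assumes "orthoprojector M"
  shows "(norm (M *v x))\<^sup>2 + (norm ((mat 1 - M) *v x))\<^sup>2 = (norm x)\<^sup>2"
proof -
  have "(M *v x) \<bullet> (M *v x) = x \<bullet> (M *v x)"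
    using orthoprojector_inner[OF assms] orthoprojector_idem[OF assms] by metis
  then show ?thesis
    by (simp add: matrix_vector_mult_diff_rdistrib power2_norm_eq_inner inner_diff_left
        inner_diff_right inner_commute)
qed

lemma norm_orthoprojector_le: "orthoprojector M \<Longrightarrow> norm (M *v x) \<le> norm x"
  by (rule power2_le_imp_le)
    (metis orthoprojector_pythagoras le_add_same_cancel1 zero_le_power2, simp)

text \<open>Ranks enter the estimates through this lemma, as the size of an orthonormal basis of the
  range. Since \<open>M\<close> fixes each \<open>b\<close>, the coefficients of
  \<open>M *v x\<close> are those of \<open>x\<close>.\<close>

lemma orthoprojector_basis:
  fixes M :: "real^'n^'n"
  assumes M: "orthoprojector M"
  obtains B where "finite B" "card B = rank M" "\<And>b. b \<in> B \<Longrightarrow> norm b = 1" "\<And>b. b \<in> B \<Longrightarrow> M *v b = b"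
    "\<And>x. (norm (M *v x))\<^sup>2 = (\<Sum>b\<in>B. (b \<bullet> x)\<^sup>2)"
proof -
  have "subspace (range ((*v) M))" by (simp add: linear_subspace_image)
  then obtain B where B: "B \<subseteq> range ((*v) M)" "pairwise orthogonal B"
    "\<And>b. b \<in> B \<Longrightarrow> norm b = 1" "independent B" "card B = dim (range ((*v) M))"
    "span B = range ((*v) M)"
    by (rule orthonormal_basis_subspace) blast
  have fin: "finite B" using B(4) by (rule independent_imp_finite)
  have Mb: "M *v b = b" if "b \<in> B" for b using that B(1) orthoprojector_idem[OF M] by auto
  have "(norm (M *v x))\<^sup>2 = (\<Sum>b\<in>B. (b \<bullet> x)\<^sup>2)" for x
  proof -
    have "(norm (M *v x))\<^sup>2 = (\<Sum>b\<in>B. (b \<bullet> (M *v x))\<^sup>2)"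
      using B(2,3,6) by (intro parseval fin) auto
    also have "\<dots> = (\<Sum>b\<in>B. (b \<bullet> x)\<^sup>2)"
      using Mb by (intro sum.cong) (auto simp flip: orthoprojector_inner[OF M])
    finally show ?thesis .
  qed
  with fin B(3,5) Mb show thesis by (intro that[of B]) (auto simp: rank_dim_range)
qed

lemma bessel_family_orthoprojector:
  assumes "bessel_family I a" "orthoprojector M"
  shows "bessel_family I (\<lambda>i. M *v a i)"
  using assms(1)
  by (rule bessel_family_comp[where L = "(*v) M"])
    (auto simp: assms(2) orthoprojector_inner norm_orthoprojector_le)

text \<open>After exchanging the sums, each of the \<open>rank M\<close> unit basis vectors
  contributes at most \<open>1\<close> by the Bessel inequality.\<close>

lemma bessel_family_orthoprojector_trace:
  assumes "bessel_family I a" "orthoprojector M"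
  shows "(\<Sum>i\<in>I. (norm (M *v a i))\<^sup>2) \<le> rank M"
proof -
  obtain B where B: "finite B" "card B = rank M" "\<And>b. b \<in> B \<Longrightarrow> norm b = 1"
    "\<And>x. (norm (M *v x))\<^sup>2 = (\<Sum>b\<in>B. (b \<bullet> x)\<^sup>2)"
    using orthoprojector_basis[OF assms(2)] by metis
  have "(\<Sum>i\<in>I. (norm (M *v a i))\<^sup>2) = (\<Sum>b\<in>B. \<Sum>i\<in>I. (a i \<bullet> b)\<^sup>2)"
    unfolding B(4) by (subst sum.swap) (simp add: inner_commute)
  also have "\<dots> \<le> (\<Sum>b\<in>B. (norm b)\<^sup>2)" by (intro sum_mono bessel_familyD assms(1))
  also have "\<dots> = rank M" using B(2,3) by simp
  finally show ?thesis .
qed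

section \<open>Blocks cut out by a pair of projectors\<close>

lemma proj_family_leD:
  assumes "P \<in> proj_family_le s"
  shows "orthoprojector (fst P)" "orthoprojector (snd P)" "rank (fst P) \<le> s" "rank (snd P) \<le> s"
  using assms by (auto simp: proj_family_le_def proj_family_def weight_def)

lemma inner_proj_app:
  assumes "P \<in> proj_family_le s"
  shows "a \<bullet> (proj_app P z *v b) = (fst P *v a) \<bullet> (z *v (snd P *v b))"
  using proj_family_leD(1)[OF assms]
  by (simp add: proj_app_def orthoprojector_inner flip: matrix_vector_mul_assoc)

lemma inner_proj_bar:
  assumes "P \<in> proj_family_le s"
  shows "a \<bullet> (proj_bar P z *v b) = ((mat 1 - fst P) *v a) \<bullet> (z *v ((mat 1 - snd P) *v b))"
  using orthoprojector_diff[OF proj_family_leD(1)[OF assms]]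
  by (simp add: proj_bar_def orthoprojector_inner flip: matrix_vector_mul_assoc)

text \<open>The projectors pass onto the test families, where the trace bound turns rank at most
  \<open>s\<close> into the length budget of \<open>Sigma_sum s\<close>.\<close>

lemma nuclear_norm_proj_app_le:
  assumes "P \<in> proj_family_le s"
  shows "nuclear_norm (proj_app P z) \<le> Sigma_sum s z"
proof -
  note P = proj_family_leD[OF assms]
  obtain I :: "nat set" and a b where ab: "bessel_family I a" "bessel_family I b"
    and "nuclear_norm (proj_app P z) = (\<Sum>i\<in>I. a i \<bullet> (proj_app P z *v b i))"
    using nuclear_norm_attained by blast
  then have "nuclear_norm (proj_app P z) = (\<Sum>i\<in>I. (fst P *v a i) \<bullet> (z *v (snd P *v b i)))"
    by (simp add: inner_proj_app[OF assms])
  also have "\<dots> \<le> Sigma_sum s z"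
    using bessel_family_orthoprojector_trace[OF ab(1) P(1)]
      bessel_family_orthoprojector_trace[OF ab(2) P(2)] P(3,4)
    by (intro inner_sum_le_Sigma_sum bessel_family_orthoprojector ab P) linarith+
  finally show ?thesis .
qed

lemma nuclear_norm_proj_bar_le:
  assumes "P \<in> proj_family_le s"
  shows "nuclear_norm (proj_bar P z) \<le> nuclear_norm z"
proof -
  note P = proj_family_leD(1,2)[OF assms, THEN orthoprojector_diff]
  obtain I :: "nat set" and a b where ab: "bessel_family I a" "bessel_family I b"
    and "nuclear_norm (proj_bar P z) = (\<Sum>i\<in>I. a i \<bullet> (proj_bar P z *v b i))"
    using nuclear_norm_attained by blast
  then have "nuclear_norm (proj_bar P z)
      = (\<Sum>i\<in>I. ((mat 1 - fst P) *v a i) \<bullet> (z *v ((mat 1 - snd P) *v b i)))"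
    by (simp add: inner_proj_bar[OF assms])
  also have "\<dots> \<le> nuclear_norm z"
    by (intro inner_sum_le_nuclear_norm bessel_family_orthoprojector ab P)
  finally show ?thesis .
qed

text \<open>With the polar factor \<open>U\<close> of \<open>z\<close>, the form \<open>x \<mapsto> U x \<bullet> z x\<close> is positive semidefinite with
  trace \<open>nuclear_norm z\<close>. It is split along the space \<open>E\<close> spanned by the ranges of \<open>P_right\<close> and
  \<open>U\<^sup>T P_left\<close>, of dimension at most \<open>2 s\<close>, and its orthogonal complement, on which \<open>z\<close> and
  \<open>proj_bar P z\<close> give the same form.\<close>
lemma nuclear_norm_le_proj_bar:
  fixes z :: "real^'q^'p"
  assumes "P \<in> proj_family_le s"
  shows "nuclear_norm z \<le> nuclear_norm (proj_bar P z) + Sigma_sum (2 * s) z"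
proof -
  note P = proj_family_leD[OF assms]
  obtain v w where svd: "is_svd z v w" using svd_exists by blast
  note v = is_svdD(1)[OF svd] and w = is_svdD(2)[OF svd]
  let ?q = "CARD('q)"
  have bw: "bessel_family {..<?q} w" by (rule bessel_family_orthogonal; simp add: w)
  \<comment> \<open>\<open>U\<close> is a partial isometry sending \<open>v j\<close> to
    \<open>w j\<close>, and \<open>U'\<close> is its adjoint.\<close>
  define U where "U x = (\<Sum>j<?q. (v j \<bullet> x) *\<^sub>R w j)" for x
  define U' where "U' y = (\<Sum>j<?q. (w j \<bullet> y) *\<^sub>R v j)" for y
  have adj: "U x \<bullet> y = x \<bullet> U' y" for x y
    by (simp add: U_def U'_def inner_sum_left inner_sum_right inner_commute mult.commute)
  \<comment> \<open>Contractivity of the adjoint makes the images under \<open>U\<close> of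
    orthonormal vectors Bessel families.\<close>
  have normU': "norm (U' y) \<le> norm y" for y
  proof -
    have "v j \<bullet> U' y = w j \<bullet> y" if "j < ?q" for j
      using that by (simp add: U'_def inner_sum_right v if_distrib[of "\<lambda>t. _ * t"] cong: if_cong)
    moreover have "U' y \<bullet> U' y = (\<Sum>j<?q. (w j \<bullet> y) * (v j \<bullet> U' y))"
      by (subst (1) U'_def) (simp add: inner_sum_left)
    ultimately have "(norm (U' y))\<^sup>2 = (\<Sum>j<?q. (w j \<bullet> y)\<^sup>2)"
      unfolding power2_norm_eq_inner by (simp add: power2_eq_square)
    also have "\<dots> \<le> (norm y)\<^sup>2" using bw by (rule bessel_familyD)
    finally show ?thesis by (rule power2_le_imp_le) simp
  qed
  have form: "U x \<bullet> (z *v x) = (\<Sum>j<?q. sigma (Suc j) z * (v j \<bullet> x)\<^sup>2)" for x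
  proof -
    have "w j \<bullet> (z *v x) = sigma (Suc j) z * (v j \<bullet> x)" if "j < ?q" for j
    proof -
      have "w j \<bullet> (z *v x) = (\<Sum>i<?q. if j = i then sigma (Suc i) z * (v i \<bullet> x) else 0)"
        unfolding is_svd_mult[OF svd] inner_sum_right
        using that w by (intro sum.cong) auto
      then show ?thesis using that by simp
    qed
    then show ?thesis
      by (simp add: U_def inner_sum_left power2_eq_square mult_ac)
  qed
  obtain Bl where Bl: "finite Bl" "card Bl = rank (fst P)"
    "\<And>x. (norm (fst P *v x))\<^sup>2 = (\<Sum>b\<in>Bl. (b \<bullet> x)\<^sup>2)"
    using orthoprojector_basis[OF P(1)] by metis
  obtain Br where Br: "finite Br" "card Br = rank (snd P)"
    "\<And>x. (norm (snd P *v x))\<^sup>2 = (\<Sum>b\<in>Br. (b \<bullet> x)\<^sup>2)"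
    using orthoprojector_basis[OF P(2)] by metis
  define E where "E = span (Br \<union> U' ` Bl)"
  define F where "F = {x. \<forall>e\<in>E. orthogonal e x}"
  have "dim E \<le> card (Br \<union> U' ` Bl)"
    unfolding E_def dim_span using Bl(1) Br(1) by (intro dim_le_card') auto
  also have "\<dots> \<le> card Br + card Bl"
    using card_Un_le[of Br "U' ` Bl"] card_image_le[OF Bl(1), of U'] by linarith
  finally have dimE: "dim E \<le> 2 * s" using P(3,4) Bl(2) Br(2) by simp
  have sub: "subspace E" "subspace F"
    by (simp_all add: E_def F_def subspace_span) (simp add: subspace_def orthogonal_clauses)
  obtain G where G: "G \<subseteq> E" "pairwise orthogonal G" "\<And>x. x \<in> G \<Longrightarrow> norm x = 1"
    "independent G" "card G = dim E" "span G = E"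
    using orthonormal_basis_subspace[OF sub(1)] by metis
  obtain H where H: "H \<subseteq> F" "pairwise orthogonal H" "\<And>x. x \<in> H \<Longrightarrow> norm x = 1"
    "independent H" "span H = F"
    using orthonormal_basis_subspace[OF sub(2)] by metis
  have fin: "finite G" "finite H" using G(4) H(4) independent_imp_finite by auto
  have bG: "bessel_family G (\<lambda>g. g)" and bH: "bessel_family H (\<lambda>h. h)"
    using G(2,3) H(2,3) fin by (auto intro: bessel_family_orthonormal_set)
  have UG: "bessel_family G U"
    using bG by (rule bessel_family_comp[where L = U']) (auto simp: adj normU')
  have UH: "bessel_family H U"
    using bH by (rule bessel_family_comp[where L = U']) (auto simp: adj normU')

  have "(\<Sum>g\<in>G. U g \<bullet> (z *v g)) \<le> Sigma_sum (2 * s) z"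
    using bessel_family_sum_norm_le[OF UG] bessel_family_sum_norm_le[OF bG] G(5) dimE
    by (intro inner_sum_le_Sigma_sum UG bG) linarith+
  moreover have "(\<Sum>h\<in>H. U h \<bullet> (z *v h)) \<le> nuclear_norm (proj_bar P z)"
  proof -
    have "snd P *v h = 0" "fst P *v U h = 0" if "h \<in> H" for h
    proof -
      have orth: "\<And>e. e \<in> E \<Longrightarrow> e \<bullet> h = 0" using that H(1) by (auto simp: F_def orthogonal_def)
      have "b \<bullet> h = 0" if "b \<in> Br" for b using that by (intro orth) (simp add: E_def span_base)
      then have "(norm (snd P *v h))\<^sup>2 = 0" unfolding Br(3) by (intro sum.neutral) simp
      then show "snd P *v h = 0" by simp
      have "b \<bullet> U h = 0" if "b \<in> Bl" for b
      proof -
        have "U' b \<bullet> h = 0" using that by (intro orth) (simp add: E_def span_base)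
        then show ?thesis by (metis adj inner_commute)
      qed
      then have "(norm (fst P *v U h))\<^sup>2 = 0" unfolding Bl(3) by (intro sum.neutral) simp
      then show "fst P *v U h = 0" by simp
    qed
    \<comment> \<open>Both complementary projectors act as the identity here, on \<open>h\<close>
      and on \<open>U h\<close>.\<close>
    then have "(\<Sum>h\<in>H. U h \<bullet> (z *v h)) = (\<Sum>h\<in>H. U h \<bullet> (proj_bar P z *v h))"
      by (intro sum.cong refl) (simp add: inner_proj_bar[OF assms] matrix_vector_mult_diff_rdistrib)
    also have "\<dots> \<le> nuclear_norm (proj_bar P z)" by (intro inner_sum_le_nuclear_norm UH bH)
    finally show ?thesis .
  qed
  moreover have "nuclear_norm z \<le> (\<Sum>g\<in>G. U g \<bullet> (z *v g)) + (\<Sum>h\<in>H. U h \<bullet> (z *v h))"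
  proof -
    \<comment> \<open>\<open>G\<close> and \<open>H\<close> together form an orthonormal basis, so
      each unit vector \<open>v j\<close> has its full squared length accounted for. By
      \<open>form\<close>, the two traces then carry every singular value with weight at least
      \<open>1\<close>.\<close>
    have "(norm x)\<^sup>2 \<le> (\<Sum>g\<in>G. (x \<bullet> g)\<^sup>2) + (\<Sum>h\<in>H. (x \<bullet> h)\<^sup>2)" for x
    proof -
      obtain y y' where y: "y \<in> E" "\<And>e. e \<in> E \<Longrightarrow> orthogonal y' e" "x = y + y'"
        using orthogonal_subspace_decomp_exists[of E x] sub(1) by (metis span_eq_iff)
      then have y': "y' \<in> F" by (auto simp: F_def orthogonal_commute)
      have "(norm x)\<^sup>2 = (norm y)\<^sup>2 + (norm y')\<^sup>2"
        using norm_add_Pythagorean[of y y'] y by (simp add: orthogonal_commute)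
      also have "(norm y)\<^sup>2 = (\<Sum>g\<in>G. (g \<bullet> y)\<^sup>2)"
        using y(1) G fin by (intro parseval) auto
      also have "\<dots> = (\<Sum>g\<in>G. (x \<bullet> g)\<^sup>2)"
        using y(2) G(1) by (intro sum.cong) (auto simp: y(3) orthogonal_def inner_simps inner_commute)
      also have "(norm y')\<^sup>2 = (\<Sum>h\<in>H. (h \<bullet> y')\<^sup>2)"
        using y' H fin by (intro parseval) auto
      also have "\<dots> = (\<Sum>h\<in>H. (x \<bullet> h)\<^sup>2)"
        using y(1) H(1) by (intro sum.cong) (auto simp: y(3) F_def orthogonal_def inner_simps inner_commute)
      finally show ?thesis by simp
    qed
    then have "1 \<le> (\<Sum>g\<in>G. (v j \<bullet> g)\<^sup>2) + (\<Sum>h\<in>H. (v j \<bullet> h)\<^sup>2)" if "j < ?q" for j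
      using v[of j j] that by (metis power2_norm_eq_inner)
    then have "(\<Sum>j<?q. sigma (Suc j) z * 1)
        \<le> (\<Sum>j<?q. sigma (Suc j) z * ((\<Sum>g\<in>G. (v j \<bullet> g)\<^sup>2) + (\<Sum>h\<in>H. (v j \<bullet> h)\<^sup>2)))"
      using sigma_nonneg by (intro sum_mono mult_left_mono) auto
    also have "\<dots> = (\<Sum>g\<in>G. U g \<bullet> (z *v g)) + (\<Sum>h\<in>H. U h \<bullet> (z *v h))"
      unfolding form 
      by (simp add: distrib_left sum.distrib sum_distrib_left sum.swap[of _ "{..<?q}" G]
          sum.swap[of _ "{..<?q}" H])
    finally show ?thesis by (simp add: nuclear_norm_eq_Sigma_sum[of "?q"] Sigma_sum_eq)
  qed
  ultimately show ?thesis by linarith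
qed

text \<open>Optimal test families for the two blocks, supported on complementary ranges, glue to one
  test family for \<open>z\<close>.\<close>

lemma nuclear_norm_pinching:
  fixes z :: "real^'q^'p"
  assumes "P \<in> proj_family_le s"
  shows "nuclear_norm (proj_app P z) + nuclear_norm (proj_bar P z) \<le> nuclear_norm z"
proof -
  note P = proj_family_leD(1,2)[OF assms]
  obtain I :: "nat set" and a b where ab: "bessel_family I a" "bessel_family I b"
    and 1: "nuclear_norm (proj_app P z) = (\<Sum>i\<in>I. a i \<bullet> (proj_app P z *v b i))"
    using nuclear_norm_attained by blast
  obtain J :: "nat set" and c d where cd: "bessel_family J c" "bessel_family J d"
    and 2: "nuclear_norm (proj_bar P z) = (\<Sum>i\<in>J. c i \<bullet> (proj_bar P z *v d i))"
    using nuclear_norm_attained by blast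
  have fin: "finite I" "finite J" using ab cd bessel_familyD by blast+
  \<comment> \<open>The Bessel bounds of the two parts hold at \<open>M *v x\<close> and
    \<open>(mat 1 - M) *v x\<close>, and Pythagoras adds them up.\<close>
  have glue: "bessel_family (I <+> J) (case_sum (\<lambda>i. M *v e i) (\<lambda>j. (mat 1 - M) *v f j))"
    if "bessel_family I e" "bessel_family J f" "orthoprojector M" for e f and M :: "real^'n^'n"
    unfolding bessel_family_def
  proof (intro conjI allI)
    fix x
    have "(\<Sum>k\<in>I <+> J. (case_sum (\<lambda>i. M *v e i) (\<lambda>j. (mat 1 - M) *v f j) k \<bullet> x)\<^sup>2)
        = (\<Sum>i\<in>I. (e i \<bullet> (M *v x))\<^sup>2) + (\<Sum>j\<in>J. (f j \<bullet> ((mat 1 - M) *v x))\<^sup>2)"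
      using fin that(3)
      by (simp add: sum.Plus orthoprojector_inner orthoprojector_diff)
    also have "\<dots> \<le> (norm (M *v x))\<^sup>2 + (norm ((mat 1 - M) *v x))\<^sup>2"
      by (intro add_mono bessel_familyD that)
    also have "\<dots> = (norm x)\<^sup>2" using that(3) by (rule orthoprojector_pythagoras)
    finally show "(\<Sum>k\<in>I <+> J. (case_sum (\<lambda>i. M *v e i) (\<lambda>j. (mat 1 - M) *v f j) k \<bullet> x)\<^sup>2)
        \<le> (norm x)\<^sup>2" .
  qed (use fin in auto)
  have "nuclear_norm (proj_app P z) + nuclear_norm (proj_bar P z)
      = (\<Sum>k\<in>I <+> J. case_sum (\<lambda>i. fst P *v a i) (\<lambda>j. (mat 1 - fst P) *v c j) k \<bullet>
          (z *v case_sum (\<lambda>i. snd P *v b i) (\<lambda>j. (mat 1 - snd P) *v d j) k))"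
    by (simp add: 1 2 sum.Plus fin inner_proj_app[OF assms] inner_proj_bar[OF assms])
  also have "\<dots> \<le> nuclear_norm z"
    by (intro inner_sum_le_nuclear_norm glue ab cd P)
  finally show ?thesis .
qed

subsection \<open>Recovery\<close>

lemma is_seminorm_minus:
  assumes "is_seminorm N"
  shows "N (- x) = N x"
proof -
  have "N ((- 1) *\<^sub>R x) = \<bar>- 1\<bar> * N x" using assms unfolding is_seminorm_def by blast
  then show ?thesis by simp
qed

lemma is_seminorm_triangle: "is_seminorm N \<Longrightarrow> N (x + y) \<le> N x + N y"
  unfolding is_seminorm_def by blast

lemma is_seminorm_diff:
  assumes "is_seminorm N"
  shows "N (x - y) \<le> N x + N y"
proof -
  have "N (x + - y) \<le> N x + N (- y)" using assms unfolding is_seminorm_def by blast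
  then show ?thesis by (simp add: is_seminorm_minus[OF assms])
qed

lemma is_seminorm_zero:
  assumes "is_seminorm N"
  shows "N 0 = 0"
proof -
  have "N (0 *\<^sub>R 0) = \<bar>0\<bar> * N 0" using assms unfolding is_seminorm_def by blast
  then show ?thesis by simp
qed

lemma is_seminorm_add:
  assumes "is_seminorm M" "is_seminorm N"
  shows "is_seminorm (\<lambda>x. M x + N x)"
  unfolding is_seminorm_def
proof (intro conjI allI)
  fix c x y
  show "0 \<le> M x + N x" using assms by (simp add: is_seminorm_def)
  show "M (c *\<^sub>R x) + N (c *\<^sub>R x) = \<bar>c\<bar> * (M x + N x)"
    using assms by (simp add: is_seminorm_def distrib_left)
  have "M (x + y) \<le> M x + M y" "N (x + y) \<le> N x + N y"
    using assms by (simp_all add: is_seminorm_def)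
  then show "M (x + y) + N (x + y) \<le> M x + N x + (M y + N y)" by linarith
qed

section \<open>The dominating norm and the two conditions\<close>

lemma is_norm_level_Sigma_sum: "is_norm_level s (\<lambda>z. Sigma_sum s z + Sigma_sum (2 * s) z)"
proof -
  have sn: "is_seminorm (\<lambda>z. Sigma_sum s z + Sigma_sum (2 * s) z)"
    by (intro is_seminorm_add is_seminorm_Sigma_sum)
  moreover have "z = 0" if "Sigma_sum s z + Sigma_sum (2 * s) z = 0" "s \<noteq> 0" for z
  proof -
    have "Sigma_sum s z = 0"
      using that(1) Sigma_sum_nonneg[of s z] Sigma_sum_nonneg[of "2 * s" z] by linarith
    then show ?thesis using that(2) by (intro Sigma_sum_eq_0D[of s]) auto
  qed
  ultimately show ?thesis by (auto simp: is_norm_level_def is_norm_def)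
qed

lemma dominates_proj_Sigma_sum: "dominates_proj s (\<lambda>z. Sigma_sum s z + Sigma_sum (2 * s) z)"
  unfolding dominates_proj_def
proof (intro allI ballI)
  fix z and P :: "('p::finite, 'q::finite) proj_pair" assume P: "P \<in> proj_family_le s"
  show "nuclear_norm (proj_app P z) + nuclear_norm z - nuclear_norm (proj_bar P z)
      \<le> Sigma_sum s z + Sigma_sum (2 * s) z"
    using nuclear_norm_proj_app_le[OF P, of z] nuclear_norm_le_proj_bar[OF P, of z] by linarith
qed

text \<open>Passage from extended to real numbers. A finite value \<open>r\<close> arises when
  \<open>\<beta>\<close> is finite and also, by the convention on \<open>\<infinity> * 0\<close>,
  when \<open>\<phi> (A z) = 0\<close>.\<close>

lemma cond_CD:
  assumes "cond_C s \<gamma> \<beta> \<phi> A" "P \<in> proj_family_le s" "\<beta> * ereal (\<phi> (A z)) = ereal r"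
  shows "nuclear_norm (proj_app P z) + nuclear_norm z - nuclear_norm (proj_bar P z)
    \<le> r + \<gamma> * nuclear_norm z"
proof -
  have "ereal (nuclear_norm (proj_app P z) + nuclear_norm z - nuclear_norm (proj_bar P z))
      \<le> \<beta> * ereal (\<phi> (A z)) + ereal (\<gamma> * nuclear_norm z)"
    using assms(1,2) unfolding cond_C_def by blast
  then show ?thesis unfolding assms(3) plus_ereal.simps ereal_less_eq .
qed

lemma cond_Cplus_imp_cond_C:
  fixes A :: "real^'b::finite^'a::finite \<Rightarrow> real^'m"
  assumes "cond_Cplus s \<gamma> \<beta> \<phi> A"
  shows "cond_C s \<gamma> \<beta> \<phi> A"
  unfolding cond_C_def
proof (intro allI ballI)
  fix z and P :: "('a, 'b) proj_pair" assume P: "P \<in> proj_family_le s"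
  obtain N where N: "dominates_proj s N"
    "\<And>z. ereal (N z) \<le> \<beta> * ereal (\<phi> (A z)) + ereal (\<gamma> * nuclear_norm z)"
    using assms unfolding cond_Cplus_def by blast
  have "ereal (nuclear_norm (proj_app P z) + nuclear_norm z - nuclear_norm (proj_bar P z)) \<le> ereal (N z)"
    using N(1) P unfolding dominates_proj_def ereal_less_eq by blast
  also note N(2)
  finally show "ereal (nuclear_norm (proj_app P z) + nuclear_norm z - nuclear_norm (proj_bar P z))
      \<le> \<beta> * ereal (\<phi> (A z)) + ereal (\<gamma> * nuclear_norm z)" .
qed

section \<open>Error bounds and s-goodness\<close>

lemma proj_app_diff: "proj_app P (x - y) = proj_app P x - proj_app P y"
  by (simp add: proj_app_def matrix_eq matrix_vector_mul_assoc[symmetric] algebra_simps)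

lemma proj_bar_diff: "proj_bar P (x - y) = proj_bar P x - proj_bar P y"
proof -
  have "proj_bar P z *v u = (mat 1 - fst P) *v (z *v ((mat 1 - snd P) *v u))" for z u
    by (simp add: proj_bar_def flip: matrix_vector_mul_assoc)
  note mult = this
  have "proj_bar P (x - y) *v u = proj_bar P x *v u - proj_bar P y *v u" for u
    by (simp only: mult matrix_vector_mult_diff_rdistrib[of x y] matrix_vector_mult_diff_distrib)
  then show ?thesis by (simp add: matrix_eq matrix_vector_mult_diff_rdistrib)
qed

lemma proj_bar_proj_app:
  assumes "P \<in> proj_family_le s"
  shows "proj_bar P (proj_app P x) = 0"
proof -
  have "(mat 1 - fst P) *v (fst P *v u) = 0" for u
    using proj_family_leD(1)[OF assms]
    by (simp add: matrix_vector_mult_diff_rdistrib orthoprojector_idem)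
  then show ?thesis
    by (simp add: proj_bar_def proj_app_def matrix_eq matrix_vector_mul_assoc[symmetric])
qed

lemma is_seminorm_nuclear_norm: "is_seminorm nuclear_norm"
  using is_norm_nuclear_norm by (auto simp: is_norm_def)

text \<open>Common core of all recovery claims: \<open>\<eta>\<close> is the allowed excess of
  \<open>xh\<close> over \<open>x\<close> in norm, \<open>r\<close> bounds the data term. With
  \<open>z = xh - x\<close>, pinching at \<open>xh\<close> and triangle inequalities give
  \<open>nuclear_norm (proj_bar P z) \<le> nuclear_norm (proj_app P z) + \<eta> + 2 *
  \<delta>x\<close>, which \<open>C\<close> converts into the bound.\<close>

lemma recovery_bound:
  fixes x xh :: "real^'q^'p"
  assumes P: "P \<in> proj_family_le s" and x: "nuclear_norm (x - proj_app P x) \<le> \<delta>x"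
    and xh: "nuclear_norm xh \<le> nuclear_norm x + \<eta>"
    and C: "nuclear_norm (proj_app P (xh - x)) + nuclear_norm (xh - x) - nuclear_norm (proj_bar P (xh - x))
      \<le> r + \<gamma> * nuclear_norm (xh - x)"
    and "\<gamma> < 1"
  shows "nuclear_norm (xh - x) \<le> (r + \<eta> + 2 * \<delta>x) / (1 - \<gamma>)"
proof -
  note sn = is_seminorm_nuclear_norm
  let ?z = "xh - x"
  have "nuclear_norm x \<le> nuclear_norm (proj_app P x) + nuclear_norm (x - proj_app P x)"
    using is_seminorm_triangle[OF sn, of "proj_app P x" "x - proj_app P x"] by simp
  moreover have "nuclear_norm (proj_app P x)
      \<le> nuclear_norm (proj_app P xh) + nuclear_norm (proj_app P ?z)"
    using is_seminorm_diff[OF sn, of "proj_app P xh" "proj_app P ?z"] by (simp add: proj_app_diff)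
  moreover have "nuclear_norm (proj_bar P ?z)
      \<le> nuclear_norm (proj_bar P xh) + nuclear_norm (proj_bar P x)"
    using is_seminorm_diff[OF sn] by (simp add: proj_bar_diff)
  \<comment> \<open>\<open>proj_bar P\<close> kills \<open>proj_app P x\<close>, so it sees only the
    non-sparse remainder of \<open>x\<close>.\<close>
  moreover have "nuclear_norm (proj_bar P x) \<le> nuclear_norm (x - proj_app P x)"
    using nuclear_norm_proj_bar_le[OF P, of "x - proj_app P x"]
    by (simp add: proj_bar_diff proj_bar_proj_app[OF P])
  moreover note nuclear_norm_pinching[OF P, of xh]
  ultimately have "nuclear_norm ?z - \<gamma> * nuclear_norm ?z \<le> r + \<eta> + 2 * \<delta>x"
    using x xh C by linarith
  then have "nuclear_norm ?z * (1 - \<gamma>) \<le> r + \<eta> + 2 * \<delta>x"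
    by (simp only: right_diff_distrib mult_1_right mult.commute[of \<gamma>])
  then show ?thesis using \<open>\<gamma> < 1\<close> by (subst pos_le_divide_eq) simp_all
qed

text \<open>The case of \<open>recovery_bound\<close> in which excess, data term and remainder are
  all zero.\<close>

lemma cond_C_imp_s_good:
  fixes A :: "real^'q^'p \<Rightarrow> real^'m"
  assumes C: "cond_C s \<gamma> \<beta> \<phi> A" and A: "linear A" and \<phi>: "is_norm \<phi>" and "\<gamma> < 1"
  shows "s_good s A"
  unfolding s_good_def
proof (intro allI impI)
  fix x xh :: "real^'q^'p"
  assume as: "sparse s x \<and> is_arg_min nuclear_norm (\<lambda>u. A u = A x) xh"
  then obtain P where P: "P \<in> proj_family_le s" "proj_app P x = x" by (auto simp: sparse_def)
  have xh: "A xh = A x" "nuclear_norm xh \<le> nuclear_norm x"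
    using as by (auto simp: is_arg_min_linorder)
  have "\<phi> (A (xh - x)) = 0"
    using \<phi> xh(1) by (simp add: linear_diff[OF A] is_norm_def is_seminorm_zero)
  \<comment> \<open>Holds for \<open>\<beta> = \<infinity>\<close> too.\<close>
  then have 0: "\<beta> * ereal (\<phi> (A (xh - x))) = ereal 0"
    by (simp flip: zero_ereal_def)
  have "nuclear_norm (x - proj_app P x) \<le> 0"
    unfolding P(2) diff_self using is_seminorm_zero[OF is_seminorm_nuclear_norm] by (rule eq_refl)
  moreover have "nuclear_norm xh \<le> nuclear_norm x + 0" using xh(2) by (simp only: add_0_right)
  ultimately have "nuclear_norm (xh - x) \<le> (0 + 0 + 2 * 0) / (1 - \<gamma>)"
    using cond_CD[OF C P(1) 0] \<open>\<gamma> < 1\<close> by (rule recovery_bound[OF P(1)])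
  then have "nuclear_norm (xh - x) \<le> 0" by (simp only: mult_zero_right add_0_right div_0)
  moreover have "0 \<le> nuclear_norm (xh - x)"
    using is_seminorm_nuclear_norm unfolding is_seminorm_def by blast
  ultimately have "nuclear_norm (xh - x) = 0" by (rule antisym)
  then have "xh - x = 0" using is_norm_nuclear_norm unfolding is_norm_def by blast
  then show "xh = x" by simp
qed

text \<open>Feasibility of \<open>x\<close> makes the excess \<open>\<delta>\<close>, and the two
  residuals together give the data term.\<close>

lemma regular_recovery:
  fixes A :: "real^'q^'p \<Rightarrow> real^'m"
  assumes C: "cond_C s \<gamma> (ereal b) \<phi> A" and A: "linear A" and \<phi>: "is_norm \<phi>"
    and "\<gamma> < 1" "0 \<le> b"
    and y: "y = A x + \<xi>" "\<phi> \<xi> \<le> \<epsilon>"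
    and P: "P \<in> proj_family_le s" "nuclear_norm (x - proj_app P x) \<le> \<delta>x"
    and xh: "\<phi> (A xh - y) \<le> \<epsilon> + \<delta>\<phi>"
      "nuclear_norm xh \<le> (INF u \<in> {u. \<phi> (A u - y) \<le> \<epsilon>}. nuclear_norm u) + \<delta>"
  shows "nuclear_norm (xh - x) \<le> (b * (2 * \<epsilon> + \<delta>\<phi>) + \<delta> + 2 * \<delta>x) / (1 - \<gamma>)"
proof (rule recovery_bound[OF P])
  have sn: "is_seminorm \<phi>" using \<phi> by (simp add: is_norm_def)
  \<comment> \<open>A real infimum is a lower bound only for sets bounded below.\<close>
  have "bdd_below (nuclear_norm ` {u. \<phi> (A u - y) \<le> \<epsilon>})"
    using is_seminorm_nuclear_norm by (intro bdd_belowI[of _ 0]) (auto simp: is_seminorm_def)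
  moreover have "\<phi> (A x - y) \<le> \<epsilon>" using y is_seminorm_minus[OF sn, of \<xi>] by simp
  ultimately have "(INF u \<in> {u. \<phi> (A u - y) \<le> \<epsilon>}. nuclear_norm u) \<le> nuclear_norm x"
    by (intro cINF_lower) auto
  with xh(2) show "nuclear_norm xh \<le> nuclear_norm x + \<delta>" by linarith
  have "A (xh - x) = (A xh - y) + \<xi>" by (simp add: linear_diff[OF A] y(1))
  then have "\<phi> (A (xh - x)) \<le> \<phi> (A xh - y) + \<phi> \<xi>" using sn by (simp add: is_seminorm_def)
  then have "\<phi> (A (xh - x)) \<le> 2 * \<epsilon> + \<delta>\<phi>" using xh(1) y(2) by linarith
  then have "b * \<phi> (A (xh - x)) \<le> b * (2 * \<epsilon> + \<delta>\<phi>)" using \<open>0 \<le> b\<close> by (rule mult_left_mono)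
  moreover have "nuclear_norm (proj_app P (xh - x)) + nuclear_norm (xh - x) - nuclear_norm (proj_bar P (xh - x))
      \<le> b * \<phi> (A (xh - x)) + \<gamma> * nuclear_norm (xh - x)"
    by (rule cond_CD[OF C P(1)]) simp
  ultimately show "nuclear_norm (proj_app P (xh - x)) + nuclear_norm (xh - x) - nuclear_norm (proj_bar P (xh - x))
      \<le> b * (2 * \<epsilon> + \<delta>\<phi>) + \<gamma> * nuclear_norm (xh - x)" by linarith
qed fact

text \<open>Comparison with \<open>x\<close> gives the excess
  \<open>\<delta> + lam * \<phi> \<xi> - lam * \<phi> ?u\<close>, possibly negative. The residual
  term \<open>lam * \<phi> ?u\<close> cancels against the same term in \<open>r\<close>, for which
  \<open>lam\<close> has to dominate \<open>b\<close>.\<close>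

lemma penalized_recovery:
  fixes A :: "real^'q^'p \<Rightarrow> real^'m"
  assumes C: "cond_C s \<gamma> (ereal b) \<phi> A" and A: "linear A" and \<phi>: "is_norm \<phi>"
    and "\<gamma> < 1" "b \<le> lam" "0 < lam"
    and y: "\<xi> = y - A x"
    and P: "P \<in> proj_family_le s" "nuclear_norm (x - proj_app P x) \<le> \<delta>x"
    and xh: "lam * \<phi> (A xh - y) + nuclear_norm xh
                     \<le> (INF z. lam * \<phi> (A z - y) + nuclear_norm z) + \<delta>"
  shows "nuclear_norm (xh - x) \<le> (2 * \<delta>x + \<delta> + 2 * lam * \<phi> \<xi>) / (1 - \<gamma>)"
proof -
  have sn: "is_seminorm \<phi>" using \<phi> by (simp add: is_norm_def)
  let ?u = "A xh - y"
  have "bdd_below (range (\<lambda>z. lam * \<phi> (A z - y) + nuclear_norm z))"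
    using is_seminorm_nuclear_norm sn \<open>0 < lam\<close>
    by (intro bdd_belowI[of _ 0]) (auto simp: is_seminorm_def intro!: add_nonneg_nonneg)
  then have inf: "(INF z. lam * \<phi> (A z - y) + nuclear_norm z) \<le> lam * \<phi> (A x - y) + nuclear_norm x"
    by (intro cINF_lower) auto
  have eq: "\<phi> (A x - y) = \<phi> \<xi>" using is_seminorm_minus[OF sn, of \<xi>] y by simp
  have "nuclear_norm xh \<le> nuclear_norm x + (\<delta> + lam * \<phi> \<xi> - lam * \<phi> ?u)"
    using xh inf[unfolded eq] by linarith
  moreover have "A (xh - x) = ?u + \<xi>" by (simp add: linear_diff[OF A] y)
  then have "\<phi> (A (xh - x)) \<le> \<phi> ?u + \<phi> \<xi>" using sn by (simp add: is_seminorm_def)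
  then have "b * \<phi> (A (xh - x)) \<le> lam * (\<phi> ?u + \<phi> \<xi>)"
    using \<open>b \<le> lam\<close> \<open>0 < lam\<close> sn
    by (intro order_trans[OF mult_right_mono[OF \<open>b \<le> lam\<close>] mult_left_mono])
      (auto simp: is_seminorm_def)
  moreover have "nuclear_norm (proj_app P (xh - x)) + nuclear_norm (xh - x) - nuclear_norm (proj_bar P (xh - x))
      \<le> b * \<phi> (A (xh - x)) + \<gamma> * nuclear_norm (xh - x)"
    by (rule cond_CD[OF C P(1)]) simp
  ultimately have "nuclear_norm (xh - x)
      \<le> (lam * (\<phi> ?u + \<phi> \<xi>) + (\<delta> + lam * \<phi> \<xi> - lam * \<phi> ?u) + 2 * \<delta>x) / (1 - \<gamma>)"
    using \<open>\<gamma> < 1\<close> by (intro recovery_bound[OF P]) linarith+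
  moreover have "lam * (\<phi> ?u + \<phi> \<xi>) + (\<delta> + lam * \<phi> \<xi> - lam * \<phi> ?u) + 2 * \<delta>x
      = 2 * \<delta>x + \<delta> + 2 * lam * \<phi> \<xi>"
    by (simp add: algebra_simps)
  ultimately show ?thesis by (simp only:)
qed

text \<open>The minima appear as real infima; under the premises the sets are nonempty and bounded
  below by \<open>0\<close>.\<close>

theorem proposition4p3:
  fixes A :: "real^'q^'p \<Rightarrow> real^'m"
    and \<phi> :: "real^'m \<Rightarrow> real"
    and s :: nat
    and \<gamma> :: real
    and \<beta> :: ereal
  assumes "CARD('q) \<le> CARD('p)"
    and "linear A"
    and "is_norm \<phi>"
    and "0 \<le> \<gamma>"
    and "0 \<le> \<beta>"
  shows "is_norm_level s (\<lambda>z :: real^'q^'p. Sigma_sum s z + Sigma_sum (2 * s) z)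
    \<and> (\<forall>z :: real^'q^'p. \<forall>P \<in> proj_family_le s.
         nuclear_norm (proj_app P z) + nuclear_norm z - nuclear_norm (proj_bar P z)
           \<le> Sigma_sum s z + Sigma_sum (2 * s) z)
    \<and> ((\<forall>z. ereal (Sigma_sum s z + Sigma_sum (2 * s) z)
              \<le> \<beta> * ereal (\<phi> (A z)) + ereal (\<gamma> * nuclear_norm z)) \<longrightarrow>
         cond_Cplus s \<gamma> \<beta> \<phi> A
       \<and> cond_C s \<gamma> \<beta> \<phi> A
       \<and> (\<gamma> < 1 \<longrightarrow>
            s_good s A
          \<and> (\<beta> < \<infinity> \<longrightarrow>
               (\<forall>\<epsilon> \<delta>x \<delta>\<phi> \<delta> x xh y \<xi>.
                   0 \<le> \<epsilon> \<and> 0 \<le> \<delta>x \<and> 0 \<le> \<delta>\<phi> \<and> 0 \<le> \<delta> \<and>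
                   y = A x + \<xi> \<and> \<phi> \<xi> \<le> \<epsilon> \<and>
                   (\<exists>P \<in> proj_family_le s. nuclear_norm (x - proj_app P x) \<le> \<delta>x) \<and>
                   \<phi> (A xh - y) \<le> \<epsilon> + \<delta>\<phi> \<and>
                   nuclear_norm xh \<le> (INF u \<in> {u. \<phi> (A u - y) \<le> \<epsilon>}. nuclear_norm u) + \<delta>
                   \<longrightarrow> nuclear_norm (xh - x)
                         \<le> (real_of_ereal \<beta> * (2 * \<epsilon> + \<delta>\<phi>) + \<delta> + 2 * \<delta>x) / (1 - \<gamma>))
             \<and> (\<forall>lam \<delta>x \<delta> x xh y \<xi>.
                   0 < lam \<and> \<beta> \<le> ereal lam \<and> 0 \<le> \<delta>x \<and> 0 \<le> \<delta> \<and>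
                   \<xi> = y - A x \<and>
                   (\<exists>P \<in> proj_family_le s. nuclear_norm (x - proj_app P x) \<le> \<delta>x) \<and>
                   lam * \<phi> (A xh - y) + nuclear_norm xh
                     \<le> (INF z. lam * \<phi> (A z - y) + nuclear_norm z) + \<delta>
                   \<longrightarrow> nuclear_norm (xh - x)
                         \<le> (2 * \<delta>x + \<delta> + 2 * lam * \<phi> \<xi>) / (1 - \<gamma>)))))"
proof (intro conjI impI)
  show "is_norm_level s (\<lambda>z :: real^'q^'p. Sigma_sum s z + Sigma_sum (2 * s) z)"
    by (rule is_norm_level_Sigma_sum)
  show "\<forall>z :: real^'q^'p. \<forall>P \<in> proj_family_le s.
         nuclear_norm (proj_app P z) + nuclear_norm z - nuclear_norm (proj_bar P z)
           \<le> Sigma_sum s z + Sigma_sum (2 * s) z"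
    using dominates_proj_Sigma_sum unfolding dominates_proj_def .
  assume "\<forall>z. ereal (Sigma_sum s z + Sigma_sum (2 * s) z)
              \<le> \<beta> * ereal (\<phi> (A z)) + ereal (\<gamma> * nuclear_norm z)"
  then show Cplus: "cond_Cplus s \<gamma> \<beta> \<phi> A"
    unfolding cond_Cplus_def
    by (intro exI[of _ "\<lambda>z. Sigma_sum s z + Sigma_sum (2 * s) z"] conjI
        is_norm_level_Sigma_sum dominates_proj_Sigma_sum)
  then show C: "cond_C s \<gamma> \<beta> \<phi> A" by (rule cond_Cplus_imp_cond_C)
  assume g: "\<gamma> < 1"
  show "s_good s A" using C \<open>linear A\<close> \<open>is_norm \<phi>\<close> g by (rule cond_C_imp_s_good)
  assume "\<beta> < \<infinity>"
  with \<open>0 \<le> \<beta>\<close> obtain b where b: "\<beta> = ereal b" "0 \<le> b" by (cases \<beta>) auto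
  note C' = C[unfolded b(1)]
  show "\<forall>\<epsilon> \<delta>x \<delta>\<phi> \<delta> x xh y \<xi>.
                   0 \<le> \<epsilon> \<and> 0 \<le> \<delta>x \<and> 0 \<le> \<delta>\<phi> \<and> 0 \<le> \<delta> \<and>
                   y = A x + \<xi> \<and> \<phi> \<xi> \<le> \<epsilon> \<and>
                   (\<exists>P \<in> proj_family_le s. nuclear_norm (x - proj_app P x) \<le> \<delta>x) \<and>
                   \<phi> (A xh - y) \<le> \<epsilon> + \<delta>\<phi> \<and>
                   nuclear_norm xh \<le> (INF u \<in> {u. \<phi> (A u - y) \<le> \<epsilon>}. nuclear_norm u) + \<delta>
                   \<longrightarrow> nuclear_norm (xh - x)
                         \<le> (real_of_ereal \<beta> * (2 * \<epsilon> + \<delta>\<phi>) + \<delta> + 2 * \<delta>x) / (1 - \<gamma>)"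
    unfolding b(1) real_of_ereal.simps
    by (intro allI impI, elim conjE bexE)
      (rule regular_recovery[OF C' \<open>linear A\<close> \<open>is_norm \<phi>\<close> g b(2)])
  show "\<forall>lam \<delta>x \<delta> x xh y \<xi>.
                   0 < lam \<and> \<beta> \<le> ereal lam \<and> 0 \<le> \<delta>x \<and> 0 \<le> \<delta> \<and>
                   \<xi> = y - A x \<and>
                   (\<exists>P \<in> proj_family_le s. nuclear_norm (x - proj_app P x) \<le> \<delta>x) \<and>
                   lam * \<phi> (A xh - y) + nuclear_norm xh
                     \<le> (INF z. lam * \<phi> (A z - y) + nuclear_norm z) + \<delta>
                   \<longrightarrow> nuclear_norm (xh - x)
                         \<le> (2 * \<delta>x + \<delta> + 2 * lam * \<phi> \<xi>) / (1 - \<gamma>)"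
    unfolding b(1) ereal_less_eq
    by (intro allI impI, elim conjE bexE)
      (rule penalized_recovery[OF C' \<open>linear A\<close> \<open>is_norm \<phi>\<close> g])
qed

end
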